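(* Let $R$ be a ring and let $\mathcal{S}$ be a right noetherian point annihilator set for $R$ (such as the set of all cocritical right ideals of $R$). Then $R$ is right noetherian if and only if every essential right ideal of $R$ lying in $\mathcal{S}$ is finitely generated.
   Context: Rings are associative with identity; modules are unital right modules. A right ideal is essential if it is an essential submodule of $R_R$, i.e. meets every nonzero right ideal nontrivially. A point annihilator of a right module $M$ is the annihilator $\mathrm{ann}(m)=\{r\in R: mr=0\}$ of some nonzero $m \in M$. A set $\mathcal{S}$ of right ideals of $R$ is a right noetherian point annihilator set for $R$ if every nonzero noetherian right $R$-module has a point annihilator lying in $\mathcal{S}$ (members of $\mathcal{S}$ are otherwise arbitrary). Krull dimension here is the Gabriel–Rentschler Krull dimension: $\mathcal{K}_{-1}$ is the class consisting of the zero module; for an ordinal $\alpha \ge 0$, $\mathcal{K}_\alpha$ is the class of modules $M$ such that for every descending chain $M_0 \supseteq M_1 \supseteq \cdots$ of submodules of $M$, $M_i/M_{i+1} \in \bigcup_{\beta<\alpha}\mathcal{K}_\beta$ for all but finitely many $i$; $\mathrm{K.dim}(M)$ is the least $\alpha$ (where $-1$ counts as an ordinal) with $M \in \mathcal{K}_\alpha$, if it exists. A module $M$ is $\alpha$-critical ($\alpha \geq 0$ an ordinal) if $\mathrm{K.dim}(M) = \alpha$ and $\mathrm{K.dim}(M/N) < \alpha$ for every nonzero submodule $N$ of $M$; it is critical if it is $\alpha$-critical for some $\alpha$. A right ideal $I$ of $R$ is cocritical if the right module $R/I$ is critical. *)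

theory Defs
  imports "HOL-Algebra.AbelCoset" "HOL-Library.Option_ord"
begin

section \<open>Right modules\<close>

text \<open>
  The library's \<open>module\<close> locale requires a commutative ring, so right modules over an
  arbitrary ring are introduced here.  As in the library, the record extends the ring record
  only in order to have \<open>zero\<close> and \<open>add\<close>; its \<open>mult\<close> and \<open>one\<close> fields play no role.
\<close>

record ('a, 'm) rmodule = "'m ring" +
  rsmult :: "'m \<Rightarrow> 'a \<Rightarrow> 'm" (infixl \<open>\<cdot>\<index>\<close> 70)

locale right_module = R?: ring R + M?: abelian_group M
  for R :: "('a, 'c) ring_scheme" (structure) and M :: "('a, 'm) rmodule" (structure) +
  assumes rsmult_closed: "\<lbrakk>x \<in> carrier M; a \<in> carrier R\<rbrakk> \<Longrightarrow> x \<cdot>\<^bsub>M\<^esub> a \<in> carrier M"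
    and rsmult_add_left: "\<lbrakk>x \<in> carrier M; y \<in> carrier M; a \<in> carrier R\<rbrakk> \<Longrightarrow>
      (x \<oplus>\<^bsub>M\<^esub> y) \<cdot>\<^bsub>M\<^esub> a = x \<cdot>\<^bsub>M\<^esub> a \<oplus>\<^bsub>M\<^esub> y \<cdot>\<^bsub>M\<^esub> a"
    and rsmult_add_right: "\<lbrakk>x \<in> carrier M; a \<in> carrier R; b \<in> carrier R\<rbrakk> \<Longrightarrow>
      x \<cdot>\<^bsub>M\<^esub> (a \<oplus>\<^bsub>R\<^esub> b) = x \<cdot>\<^bsub>M\<^esub> a \<oplus>\<^bsub>M\<^esub> x \<cdot>\<^bsub>M\<^esub> b"
    and rsmult_assoc: "\<lbrakk>x \<in> carrier M; a \<in> carrier R; b \<in> carrier R\<rbrakk> \<Longrightarrow>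
      x \<cdot>\<^bsub>M\<^esub> (a \<otimes>\<^bsub>R\<^esub> b) = (x \<cdot>\<^bsub>M\<^esub> a) \<cdot>\<^bsub>M\<^esub> b"
    and rsmult_one: "x \<in> carrier M \<Longrightarrow> x \<cdot>\<^bsub>M\<^esub> \<one>\<^bsub>R\<^esub> = x"

definition rsubmodule :: "('a, 'c) ring_scheme \<Rightarrow> ('a, 'm) rmodule \<Rightarrow> 'm set \<Rightarrow> bool" where
  "rsubmodule R M N \<longleftrightarrow> additive_subgroup N M \<and> (\<forall>x\<in>N. \<forall>a\<in>carrier R. x \<cdot>\<^bsub>M\<^esub> a \<in> N)"

definition zero_rmodule :: "('a, 'm) rmodule \<Rightarrow> bool" where
  "zero_rmodule M \<longleftrightarrow> carrier M = {\<zero>\<^bsub>M\<^esub>}"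

definition rspan :: "('a, 'c) ring_scheme \<Rightarrow> ('a, 'm) rmodule \<Rightarrow> 'm set \<Rightarrow> 'm set" where
  "rspan R M A = \<Inter>{N. rsubmodule R M N \<and> A \<subseteq> N}"

definition finitely_generated ::
    "('a, 'c) ring_scheme \<Rightarrow> ('a, 'm) rmodule \<Rightarrow> 'm set \<Rightarrow> bool" where
  "finitely_generated R M N \<longleftrightarrow> (\<exists>A. finite A \<and> A \<subseteq> carrier M \<and> N = rspan R M A)"

definition noetherian_rmodule :: "('a, 'c) ring_scheme \<Rightarrow> ('a, 'm) rmodule \<Rightarrow> bool" where
  "noetherian_rmodule R M \<longleftrightarrow> right_module R M \<and>
     (\<forall>C :: nat \<Rightarrow> 'm set.
        (\<forall>i. rsubmodule R M (C i)) \<and> (\<forall>i. C i \<subseteq> C (Suc i)) \<longrightarrow> (\<exists>n. \<forall>i\<ge>n. C i = C n))"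

definition essential_submodule ::
    "('a, 'c) ring_scheme \<Rightarrow> ('a, 'm) rmodule \<Rightarrow> 'm set \<Rightarrow> bool" where
  "essential_submodule R M N \<longleftrightarrow> rsubmodule R M N \<and>
     (\<forall>L. rsubmodule R M L \<and> L \<noteq> {\<zero>\<^bsub>M\<^esub>} \<longrightarrow> N \<inter> L \<noteq> {\<zero>\<^bsub>M\<^esub>})"

definition annihilator :: "('a, 'c) ring_scheme \<Rightarrow> ('a, 'm) rmodule \<Rightarrow> 'm \<Rightarrow> 'a set" where
  "annihilator R M m = {r \<in> carrier R. m \<cdot>\<^bsub>M\<^esub> r = \<zero>\<^bsub>M\<^esub>}"

definition point_annihilator ::
    "('a, 'c) ring_scheme \<Rightarrow> ('a, 'm) rmodule \<Rightarrow> 'a set \<Rightarrow> bool" where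
  "point_annihilator R M I \<longleftrightarrow> (\<exists>m\<in>carrier M. m \<noteq> \<zero>\<^bsub>M\<^esub> \<and> I = annihilator R M m)"

definition regular_rmodule :: "('a, 'c) ring_scheme \<Rightarrow> ('a, 'a) rmodule" where
  "regular_rmodule R = \<lparr>carrier = carrier R, mult = mult R, one = one R,
     zero = zero R, add = add R, rsmult = mult R\<rparr>"

abbreviation right_ideal :: "('a, 'c) ring_scheme \<Rightarrow> 'a set \<Rightarrow> bool" where
  "right_ideal R I \<equiv> rsubmodule R (regular_rmodule R) I"

definition right_noetherian :: "('a, 'c) ring_scheme \<Rightarrow> bool" where
  "right_noetherian R \<longleftrightarrow> noetherian_rmodule R (regular_rmodule R)"

abbreviation essential_right_ideal :: "('a, 'c) ring_scheme \<Rightarrow> 'a set \<Rightarrow> bool" where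
  "essential_right_ideal R I \<equiv> essential_submodule R (regular_rmodule R) I"


section \<open>Noetherian point annihilator sets\<close>

text \<open>
  A formula cannot quantify over all types, so the type \<open>'m\<close> carrying the test modules is a
  parameter.  The condition for the type \<open>'a list\<close>, where \<open>'a\<close> is the type of ring elements,
  implies the condition for every other type: see
  \<open>right_noetherian_point_annihilator_set_any_type\<close> below.
\<close>

definition right_noetherian_point_annihilator_set ::
    "'m itself \<Rightarrow> ('a, 'c) ring_scheme \<Rightarrow> 'a set set \<Rightarrow> bool" where
  "right_noetherian_point_annihilator_set T R S \<longleftrightarrow> (\<forall>I\<in>S. right_ideal R I) \<and>
     (\<forall>M :: ('a, 'm) rmodule. noetherian_rmodule R M \<and> \<not> zero_rmodule M \<longrightarrow>
        (\<exists>I\<in>S. point_annihilator R M I))"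

lemma right_noetherian_point_annihilator_set_any_type:
  fixes R :: "('a, 'c) ring_scheme"
  assumes "right_noetherian_point_annihilator_set TYPE('a list) R S"
  shows "right_noetherian_point_annihilator_set TYPE('m) R S"
  unfolding right_noetherian_point_annihilator_set_def
proof (intro conjI allI impI)
  show "\<forall>I\<in>S. right_ideal R I"
    using assms by (simp add: right_noetherian_point_annihilator_set_def)
next
  fix M :: "('a, 'm) rmodule"
  assume "noetherian_rmodule R M \<and> \<not> zero_rmodule M"
  then have noeth: "noetherian_rmodule R M" and nz: "carrier M \<noteq> {\<zero>\<^bsub>M\<^esub>}"
    by (auto simp: zero_rmodule_def)
  interpret right_module R M using noeth by (simp add: noetherian_rmodule_def)
  obtain m where m: "m \<in> carrier M" "m \<noteq> \<zero>\<^bsub>M\<^esub>" using nz M.zero_closed by blast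
  define C where "C = (\<lambda>r. m \<cdot>\<^bsub>M\<^esub> r) ` carrier R"
  define f where "f x = [SOME r. r \<in> carrier R \<and> m \<cdot>\<^bsub>M\<^esub> r = x]" for x
  define g where "g l = m \<cdot>\<^bsub>M\<^esub> hd l" for l :: "'a list"
  have gf: "g (f x) = x" if "x \<in> C" for x
  proof -
    have "\<exists>r. r \<in> carrier R \<and> m \<cdot>\<^bsub>M\<^esub> r = x" using that by (auto simp: C_def)
    from someI_ex[OF this] show ?thesis by (simp add: f_def g_def)
  qed
  have CM: "C \<subseteq> carrier M" using m by (auto simp: C_def rsmult_closed)
  have Cadd: "x \<oplus>\<^bsub>M\<^esub> y \<in> C" if "x \<in> C" "y \<in> C" for x y
    using that m unfolding C_def
    by (auto simp: rsmult_add_right[symmetric] intro!: imageI R.add.m_closed)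
  have Csm: "x \<cdot>\<^bsub>M\<^esub> a \<in> C" if "x \<in> C" "a \<in> carrier R" for x a
    using that m unfolding C_def
    by (auto simp: rsmult_assoc[symmetric] intro!: imageI R.m_closed)
  have mz: "x \<cdot>\<^bsub>M\<^esub> \<zero>\<^bsub>R\<^esub> = \<zero>\<^bsub>M\<^esub>" if "x \<in> carrier M" for x
  proof -
    have "x \<cdot>\<^bsub>M\<^esub> \<zero>\<^bsub>R\<^esub> \<oplus>\<^bsub>M\<^esub> x \<cdot>\<^bsub>M\<^esub> \<zero>\<^bsub>R\<^esub> = x \<cdot>\<^bsub>M\<^esub> \<zero>\<^bsub>R\<^esub>"
      using rsmult_add_right[of x "\<zero>\<^bsub>R\<^esub>" "\<zero>\<^bsub>R\<^esub>"] that by simp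
    then show ?thesis using that rsmult_closed[of x "\<zero>\<^bsub>R\<^esub>"]
      by (metis M.add.r_cancel_one' R.zero_closed)
  qed
  have C0: "\<zero>\<^bsub>M\<^esub> \<in> C" unfolding C_def using mz[OF m(1)] R.zero_closed by (metis imageI)
  have Cneg: "\<exists>y\<in>C. y \<oplus>\<^bsub>M\<^esub> x = \<zero>\<^bsub>M\<^esub>" if x: "x \<in> C" for x
  proof -
    obtain r where r: "r \<in> carrier R" "x = m \<cdot>\<^bsub>M\<^esub> r" using x by (auto simp: C_def)
    have "m \<cdot>\<^bsub>M\<^esub> (\<ominus>\<^bsub>R\<^esub> r) \<oplus>\<^bsub>M\<^esub> x = \<zero>\<^bsub>M\<^esub>"
      using r m mz rsmult_add_right[of m "\<ominus>\<^bsub>R\<^esub> r" r] by (simp add: R.l_neg)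
    then show ?thesis using r by (auto simp: C_def)
  qed
  define M' :: "('a, 'a list) rmodule" where "M' = \<lparr>carrier = f ` C, mult = undefined, one = undefined, zero = f \<zero>\<^bsub>M\<^esub>,
     add = (\<lambda>u v. f (g u \<oplus>\<^bsub>M\<^esub> g v)), rsmult = (\<lambda>u a. f (g u \<cdot>\<^bsub>M\<^esub> a))\<rparr>"
  have fC: "f x = f y \<longleftrightarrow> x = y" if "x \<in> C" "y \<in> C" for x y using gf that by metis
  have ag: "abelian_group M'"
  proof (rule abelian_groupI)
    fix x assume "x \<in> carrier M'"
    then obtain u where u: "u \<in> C" "x = f u" by (auto simp: M'_def)
    then obtain v where "v \<in> C" "v \<oplus>\<^bsub>M\<^esub> u = \<zero>\<^bsub>M\<^esub>" using Cneg by blast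
    then show "\<exists>y\<in>carrier M'. y \<oplus>\<^bsub>M'\<^esub> x = \<zero>\<^bsub>M'\<^esub>"
      using u by (auto simp: M'_def gf intro!: bexI[of _ v])
  qed (use CM in \<open>auto simp: M'_def gf C0 Cadd fC subset_iff M.a_ac\<close>)
  have rm: "right_module R M'"
  proof (intro right_module.intro right_module_axioms.intro ag R.ring_axioms)
  qed (use CM in \<open>auto simp: M'_def gf C0 Cadd Csm fC subset_iff
        rsmult_add_left rsmult_add_right rsmult_assoc rsmult_one\<close>)
  have sub: "rsubmodule R M (g ` N)" if N: "rsubmodule R M' N" for N
  proof -
    have NC: "N \<subseteq> f ` C" and N0: "f \<zero>\<^bsub>M\<^esub> \<in> N"
      and Nadd: "\<And>u v. \<lbrakk>u \<in> N; v \<in> N\<rbrakk> \<Longrightarrow> f (g u \<oplus>\<^bsub>M\<^esub> g v) \<in> N"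
      and Nsm: "\<And>u a. \<lbrakk>u \<in> N; a \<in> carrier R\<rbrakk> \<Longrightarrow> f (g u \<cdot>\<^bsub>M\<^esub> a) \<in> N"
      using N additive_subgroup.a_subset[of N M'] additive_subgroup.zero_closed[of N M']
        additive_subgroup.a_closed[of N M']
      by (auto simp: rsubmodule_def M'_def)
    have gC: "g u \<in> C" if "u \<in> N" for u using that NC gf by auto
    have sm: "g u \<cdot>\<^bsub>M\<^esub> a \<in> g ` N" if "u \<in> N" "a \<in> carrier R" for u a
      using Nsm[OF that] gf[OF Csm[OF gC[OF that(1)] that(2)]] by (metis imageI)
    have "subgroup (g ` N) (add_monoid M)"
    proof (rule M.add.subgroupI)
      show "g ` N \<subseteq> carrier M" using gC CM by auto
      show "g ` N \<noteq> {}" using N0 by auto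
    next
      fix x assume "x \<in> g ` N"
      then obtain u where u: "u \<in> N" "x = g u" by auto
      have xM: "x \<in> carrier M" using u gC CM by auto
      have "x \<cdot>\<^bsub>M\<^esub> (\<ominus>\<^bsub>R\<^esub> \<one>\<^bsub>R\<^esub>) \<oplus>\<^bsub>M\<^esub> x = \<zero>\<^bsub>M\<^esub>"
        using rsmult_add_right[OF xM, of "\<ominus>\<^bsub>R\<^esub> \<one>\<^bsub>R\<^esub>" "\<one>\<^bsub>R\<^esub>"] mz[OF xM] rsmult_one[OF xM]
        by (simp add: R.l_neg)
      then have "x \<cdot>\<^bsub>M\<^esub> (\<ominus>\<^bsub>R\<^esub> \<one>\<^bsub>R\<^esub>) = \<ominus>\<^bsub>M\<^esub> x"
        using M.minus_equality xM rsmult_closed[OF xM] R.a_inv_closed R.one_closed by metis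
      then show "\<ominus>\<^bsub>M\<^esub> x \<in> g ` N" using sm[OF u(1), of "\<ominus>\<^bsub>R\<^esub> \<one>\<^bsub>R\<^esub>"] u by simp
    next
      fix x y assume "x \<in> g ` N" "y \<in> g ` N"
      then obtain u v where "u \<in> N" "v \<in> N" "x = g u" "y = g v" by auto
      then show "x \<oplus>\<^bsub>M\<^esub> y \<in> g ` N"
        using Nadd[of u v] gf[OF Cadd[OF gC gC], of u v] by (metis imageI)
    qed
    then show ?thesis using sm by (auto simp: rsubmodule_def additive_subgroup_def)
  qed
  have noeth': "noetherian_rmodule R M'"
    unfolding noetherian_rmodule_def
  proof (intro conjI rm allI impI)
    fix F :: "nat \<Rightarrow> 'a list set"
    assume F: "(\<forall>i. rsubmodule R M' (F i)) \<and> (\<forall>i. F i \<subseteq> F (Suc i))"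
    have "(\<forall>i. rsubmodule R M (g ` F i)) \<and> (\<forall>i. g ` F i \<subseteq> g ` F (Suc i))"
      using F sub by (simp add: image_mono)
    with noeth have "\<exists>n. \<forall>i\<ge>n. g ` F i = g ` F n"
      unfolding noetherian_rmodule_def by (elim conjE) (drule spec[of _ "\<lambda>i. g ` F i"], simp)
    then obtain n where n: "\<And>i. i \<ge> n \<Longrightarrow> g ` F i = g ` F n" by auto
    have "F i \<subseteq> f ` C" for i
      using F additive_subgroup.a_subset[of "F i" M'] by (auto simp: rsubmodule_def M'_def)
    then have "f ` g ` F i = F i" for i using gf by (force simp: image_image)
    then show "\<exists>n. \<forall>i\<ge>n. F i = F n" using n by metis
  qed
  have "\<not> zero_rmodule M'"
  proof -
    have "m \<in> C" unfolding C_def using rsmult_one[OF m(1)] R.one_closed by (metis imageI)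
    then show ?thesis using m fC C0 by (auto simp: zero_rmodule_def M'_def)
  qed
  with noeth' assms obtain I where I: "I \<in> S" "point_annihilator R M' I"
    unfolding right_noetherian_point_annihilator_set_def by blast
  then obtain x where x: "x \<in> C" "f x \<noteq> f \<zero>\<^bsub>M\<^esub>" "I = annihilator R M' (f x)"
    by (auto simp: point_annihilator_def M'_def)
  have "annihilator R M' (f x) = annihilator R M x"
    using x by (auto simp: annihilator_def M'_def gf fC Csm C0)
  then have "point_annihilator R M I"
    unfolding point_annihilator_def using x CM by (intro bexI[of _ x]) auto
  with I(1) show "\<exists>I\<in>S. point_annihilator R M I" by blast
qed


section \<open>Quotient modules\<close>

text \<open>
  The recursion defining the classes \<open>\<K>\<^sub>\<alpha>\<close> passes to quotients and must stay within one
  type, so \<open>M/N\<close> is realised on representatives: \<open>coset_rep M N\<close> chooses one element in every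
  coset of \<open>N\<close>, and the operations of \<open>M\<close> are followed by \<open>coset_rep M N\<close>.  Choosing
  representatives is an isomorphism from the module of cosets to this one, see
  \<open>coset_rep_eq_iff\<close> and \<open>rquot_hom\<close>.
\<close>

definition coset_rep :: "('a, 'm) rmodule \<Rightarrow> 'm set \<Rightarrow> 'm \<Rightarrow> 'm" where
  "coset_rep M N x = (SOME y. y \<in> N +>\<^bsub>M\<^esub> x)"

definition rquot :: "('a, 'm) rmodule \<Rightarrow> 'm set \<Rightarrow> ('a, 'm) rmodule" where
  "rquot M N = M\<lparr>carrier := coset_rep M N ` carrier M,
     zero := coset_rep M N \<zero>\<^bsub>M\<^esub>,
     add := (\<lambda>x y. coset_rep M N (x \<oplus>\<^bsub>M\<^esub> y)),
     rsmult := (\<lambda>x a. coset_rep M N (x \<cdot>\<^bsub>M\<^esub> a))\<rparr>"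

context right_module
begin

lemma coset_rep_obtain:
  assumes "rsubmodule R M N" "x \<in> carrier M"
  obtains n where "n \<in> N" "n \<in> carrier M" "coset_rep M N x = n \<oplus>\<^bsub>M\<^esub> x"
proof -
  interpret N: abelian_subgroup N M
    using assms by (simp add: rsubmodule_def abelian_subgroupI3 M.abelian_group_axioms)
  have "\<exists>y. y \<in> N +>\<^bsub>M\<^esub> x"
    using assms(2) N.a_rcos_self by blast
  then have "coset_rep M N x \<in> N +>\<^bsub>M\<^esub> x" unfolding coset_rep_def by (rule someI_ex)
  then show ?thesis using that N.a_subset by (auto simp: a_r_coset_def')
qed

lemma coset_rep_eq_iff:
  assumes N: "rsubmodule R M N" and xy: "x \<in> carrier M" "y \<in> carrier M"
  shows "coset_rep M N x = coset_rep M N y \<longleftrightarrow> N +>\<^bsub>M\<^esub> x = N +>\<^bsub>M\<^esub> y"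
proof
  interpret N: abelian_subgroup N M
    using N by (simp add: rsubmodule_def abelian_subgroupI3 M.abelian_group_axioms)
  have eq: "N +>\<^bsub>M\<^esub> z = N +>\<^bsub>M\<^esub> coset_rep M N z" if z: "z \<in> carrier M" for z
  proof -
    obtain n where n: "n \<in> N" "coset_rep M N z = n \<oplus>\<^bsub>M\<^esub> z"
      using coset_rep_obtain[OF N z] by metis
    then have "coset_rep M N z \<in> N +>\<^bsub>M\<^esub> z" by (auto simp: a_r_coset_def')
    then show ?thesis using M.a_repr_independence[OF _ z N.a_subgroup] by blast
  qed
  assume "coset_rep M N x = coset_rep M N y"
  then show "N +>\<^bsub>M\<^esub> x = N +>\<^bsub>M\<^esub> y" using eq xy by metis
qed (simp add: coset_rep_def)

lemma coset_rep_eqI: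
  assumes N: "rsubmodule R M N" and "y \<in> carrier M" "n \<in> N" "x = n \<oplus>\<^bsub>M\<^esub> y"
  shows "coset_rep M N x = coset_rep M N y"
proof -
  interpret N: abelian_subgroup N M
    using N by (simp add: rsubmodule_def abelian_subgroupI3 M.abelian_group_axioms)
  have "x \<in> N +>\<^bsub>M\<^esub> y" using assms by (auto simp: a_r_coset_def')
  then have "N +>\<^bsub>M\<^esub> y = N +>\<^bsub>M\<^esub> x" using M.a_repr_independence[OF _ assms(2) N.a_subgroup] by blast
  then show ?thesis by (simp add: coset_rep_def)
qed

text \<open>
  The projection \<open>coset_rep M N\<close> is a surjective homomorphism from \<open>M\<close> to \<open>rquot M N\<close>,
  and by \<open>coset_rep_eq_iff\<close> its fibres are the cosets of \<open>N\<close>.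
\<close>

lemma rquot_hom:
  assumes N: "rsubmodule R M N"
  shows "carrier (rquot M N) = coset_rep M N ` carrier M"
    and "\<zero>\<^bsub>rquot M N\<^esub> = coset_rep M N \<zero>\<^bsub>M\<^esub>"
    and "\<lbrakk>x \<in> carrier M; y \<in> carrier M\<rbrakk> \<Longrightarrow>
      coset_rep M N x \<oplus>\<^bsub>rquot M N\<^esub> coset_rep M N y = coset_rep M N (x \<oplus>\<^bsub>M\<^esub> y)"
    and "\<lbrakk>x \<in> carrier M; a \<in> carrier R\<rbrakk> \<Longrightarrow>
      coset_rep M N x \<cdot>\<^bsub>rquot M N\<^esub> a = coset_rep M N (x \<cdot>\<^bsub>M\<^esub> a)"
proof -
  interpret N: abelian_subgroup N M
    using N by (simp add: rsubmodule_def abelian_subgroupI3 M.abelian_group_axioms)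
  show "carrier (rquot M N) = coset_rep M N ` carrier M"
    and "\<zero>\<^bsub>rquot M N\<^esub> = coset_rep M N \<zero>\<^bsub>M\<^esub>" by (simp_all add: rquot_def)
  show "coset_rep M N x \<oplus>\<^bsub>rquot M N\<^esub> coset_rep M N y = coset_rep M N (x \<oplus>\<^bsub>M\<^esub> y)"
    if x: "x \<in> carrier M" and y: "y \<in> carrier M"
  proof -
    obtain n where n: "n \<in> N" "n \<in> carrier M" "coset_rep M N x = n \<oplus>\<^bsub>M\<^esub> x"
      using coset_rep_obtain[OF N x] by metis
    obtain k where k: "k \<in> N" "k \<in> carrier M" "coset_rep M N y = k \<oplus>\<^bsub>M\<^esub> y"
      using coset_rep_obtain[OF N y] by metis
    have "(n \<oplus>\<^bsub>M\<^esub> x) \<oplus>\<^bsub>M\<^esub> (k \<oplus>\<^bsub>M\<^esub> y) = (n \<oplus>\<^bsub>M\<^esub> k) \<oplus>\<^bsub>M\<^esub> (x \<oplus>\<^bsub>M\<^esub> y)"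
      using n k x y by (simp add: M.a_ac)
    then show ?thesis
      using n k x y coset_rep_eqI[OF N, of "x \<oplus>\<^bsub>M\<^esub> y" "n \<oplus>\<^bsub>M\<^esub> k"]
      by (simp add: rquot_def N.a_closed)
  qed
  show "coset_rep M N x \<cdot>\<^bsub>rquot M N\<^esub> a = coset_rep M N (x \<cdot>\<^bsub>M\<^esub> a)"
    if x: "x \<in> carrier M" and a: "a \<in> carrier R"
  proof -
    obtain n where n: "n \<in> N" "n \<in> carrier M" "coset_rep M N x = n \<oplus>\<^bsub>M\<^esub> x"
      using coset_rep_obtain[OF N x] by metis
    have "n \<cdot>\<^bsub>M\<^esub> a \<in> N" using N n(1) a by (simp add: rsubmodule_def)
    then show ?thesis
      using n x a coset_rep_eqI[OF N, of "x \<cdot>\<^bsub>M\<^esub> a" "n \<cdot>\<^bsub>M\<^esub> a"]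
      by (simp add: rquot_def rsmult_closed rsmult_add_left)
  qed
qed

lemma right_module_rquot:
  assumes N: "rsubmodule R M N"
  shows "right_module R (rquot M N)"
proof -
  note h = rquot_hom[OF N]
  have "abelian_group (rquot M N)"
  proof (rule abelian_groupI)
    fix x assume "x \<in> carrier (rquot M N)"
    then obtain u where u: "u \<in> carrier M" "x = coset_rep M N u" by (auto simp: h(1))
    then have "coset_rep M N (\<ominus>\<^bsub>M\<^esub> u) \<oplus>\<^bsub>rquot M N\<^esub> x = \<zero>\<^bsub>rquot M N\<^esub>"
      by (simp add: h M.l_neg)
    then show "\<exists>y\<in>carrier (rquot M N). y \<oplus>\<^bsub>rquot M N\<^esub> x = \<zero>\<^bsub>rquot M N\<^esub>"
      using u by (auto simp: h(1))
  qed (auto simp: h M.a_ac)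
  then show ?thesis
    by (intro right_module.intro right_module_axioms.intro R.ring_axioms)
      (auto simp: h rsmult_closed rsmult_add_left rsmult_add_right rsmult_assoc rsmult_one)
qed

end


section \<open>Ordinals\<close>

text \<open>
  The ordinals that are order types of well-orders on sets of elements of \<open>'b\<close>.
\<close>

quotient_type 'b ordinal = "'b rel" / partial: "\<lambda>r s. (r, s) \<in> (ordIso :: ('b rel \<times> 'b rel) set)"
proof (rule part_equivpI)
  show "\<exists>r :: 'b rel. (r, r) \<in> ordIso"
    using card_of_Well_order ordIso_reflexive by blast
  show "symp (\<lambda>r s :: 'b rel. (r, s) \<in> ordIso)"
    by (auto intro: sympI ordIso_symmetric)
  show "transp (\<lambda>r s :: 'b rel. (r, s) \<in> ordIso)"
    by (auto intro: transpI ordIso_transitive)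
qed

instantiation ordinal :: (type) wellorder
begin

lift_definition less_eq_ordinal :: "'b ordinal \<Rightarrow> 'b ordinal \<Rightarrow> bool"
  is "\<lambda>r s. (r, s) \<in> ordLeq"
  by (meson ordIso_ordLeq_trans ordIso_symmetric ordLeq_ordIso_trans)

lift_definition less_ordinal :: "'b ordinal \<Rightarrow> 'b ordinal \<Rightarrow> bool"
  is "\<lambda>r s. (r, s) \<in> ordLess"
  by (meson ordIso_ordLess_trans ordIso_symmetric ordLess_ordIso_trans)

instance
proof
  fix x y z :: "'b ordinal"
  have wo: "(r, r) \<in> ordIso \<Longrightarrow> Well_order r" for r :: "'b rel"
    by (simp add: ordIso_def)
  show "x < y \<longleftrightarrow> x \<le> y \<and> \<not> y \<le> x"
    by transfer (meson ordLess_imp_ordLeq not_ordLess_ordLeq not_ordLeq_iff_ordLess wo)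
  show "x \<le> x" by transfer (simp add: ordLeq_reflexive wo)
  show "x \<le> y \<Longrightarrow> y \<le> z \<Longrightarrow> x \<le> z" by transfer (rule ordLeq_transitive)
  show "x \<le> y \<Longrightarrow> y \<le> x \<Longrightarrow> x = y" by transfer (simp add: ordIso_iff_ordLeq)
  show "x \<le> y \<or> y \<le> x" by transfer (simp add: ordLeq_total wo)
next
  fix P :: "'b ordinal \<Rightarrow> bool" and a
  assume step: "\<And>x. (\<And>y. y < x \<Longrightarrow> P y) \<Longrightarrow> P x"
  have "wf {(x, y :: 'b ordinal). x < y}"
  proof -
    have "{(x, y :: 'b ordinal). x < y} \<subseteq> inv_image ordLess rep_ordinal"
      by (auto simp: less_ordinal.rep_eq)
    then show ?thesis by (rule wf_subset[OF wf_inv_image[OF wf_ordLess]])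
  qed
  then show "P a" by (rule wf_induct_rule) (use step in auto)
qed

end


section \<open>Krull dimension\<close>

text \<open>
  In \<open>'b ordinal option\<close> the least element \<open>None\<close> stands for \<open>-1\<close>.  The type
  \<open>'m set ordinal\<close> is large enough for modules on the type \<open>'m\<close>: if the Krull dimension of
  a module exists, then every smaller ordinal is the Krull dimension of a subfactor, so it has
  cardinality at most that of \<open>'m set \<times> 'm set\<close>, that is of \<open>'m set\<close> if \<open>'m\<close> is
  infinite; and a finite module has Krull dimension at most \<open>0\<close>.
\<close>

inductive krull_class ::
    "('a, 'c) ring_scheme \<Rightarrow> 'm set ordinal option \<Rightarrow> ('a, 'm) rmodule \<Rightarrow> bool"
  for R :: "('a, 'c) ring_scheme" where
  minus_one: "\<lbrakk>right_module R M; zero_rmodule M\<rbrakk> \<Longrightarrow> krull_class R None M"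
| ordinal: "\<lbrakk>right_module R M;
     \<forall>C :: nat \<Rightarrow> 'm set.
       (\<forall>i. rsubmodule R M (C i)) \<and> (\<forall>i. C (Suc i) \<subseteq> C i) \<longrightarrow>
       (\<exists>n. \<forall>i\<ge>n. \<exists>\<beta><Some \<alpha>. krull_class R \<beta> (rquot (M\<lparr>carrier := C i\<rparr>) (C (Suc i))))\<rbrakk>
   \<Longrightarrow> krull_class R (Some \<alpha>) M"

definition is_krull_dim ::
    "('a, 'c) ring_scheme \<Rightarrow> ('a, 'm) rmodule \<Rightarrow> 'm set ordinal option \<Rightarrow> bool" where
  "is_krull_dim R M \<alpha> \<longleftrightarrow> krull_class R \<alpha> M \<and> (\<forall>\<beta><\<alpha>. \<not> krull_class R \<beta> M)"

definition critical_rmodule :: "('a, 'c) ring_scheme \<Rightarrow> ('a, 'm) rmodule \<Rightarrow> bool" where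
  "critical_rmodule R M \<longleftrightarrow> (\<exists>\<alpha>. is_krull_dim R M (Some \<alpha>) \<and>
     (\<forall>N. rsubmodule R M N \<and> N \<noteq> {\<zero>\<^bsub>M\<^esub>} \<longrightarrow> (\<exists>\<beta><Some \<alpha>. is_krull_dim R (rquot M N) \<beta>)))"

definition cocritical :: "('a, 'c) ring_scheme \<Rightarrow> 'a set \<Rightarrow> bool" where
  "cocritical R I \<longleftrightarrow> right_ideal R I \<and> critical_rmodule R (rquot (regular_rmodule R) I)"

end

(*
  A right ideal P maximal among those that are not finitely generated is essential, since a
  nonzero L with P \<inter> L = 0 would make P + L, hence P, finitely generated; and R/P is noetherian.
  A point annihilator (P : m) of R/P in the given set is again essential, so it is finitely
  generated, and this forces P to be finitely generated.

  For the cocritical right ideals, choose m \<noteq> 0 in the noetherian module M such that mR has the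
  least possible Krull dimension \<alpha>.  If no nonzero nR \<subseteq> mR were critical, each would contain a
  nonzero K with K.dim(nR/K) \<ge> \<alpha>; choosing n' \<noteq> 0 in K and repeating gives a descending chain
  in mR all of whose factors have Krull dimension at least \<alpha>, a contradiction.
*)

theory Submission
  imports Defs
begin

section \<open>Submodules and homomorphisms\<close>

text \<open>The obstacle is comparing dimensions. Criticality of \<open>R / ann(m)\<close> is tested
  with ordinals in \<open>'a set ordinal\<close>, whereas the Krull dimension of a module carried by
  \<open>'m\<close> lies in \<open>'m set ordinal\<close>; moreover quotients of quotients are
  formed on chosen representatives. Both difficulties disappear in the lattice of submodules of one
  fixed module: a subfactor K/L becomes the interval [L, K], whose deviation can be measured in any
  well-ordered type. The isomorphism of mR with \<open>R / ann(m)\<close> translates between Krull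
  dimension and deviation. A least dimension presupposes that some dimension exists. For noetherian
  modules it comes from a rank function, and the ranks have to fit into
  \<open>'a set ordinal\<close>. They do for a cyclic module, because a submodule K of mR is
  determined by the set of all r in R with mr in K. Hence only cyclic submodules are compared. The
  factors nR/n'R of the final chain are large because nR/n'R maps onto nR/K.\<close>

context right_module
begin

lemma rsmult_zero_right:
  assumes "x \<in> carrier M"
  shows "x \<cdot>\<^bsub>M\<^esub> \<zero>\<^bsub>R\<^esub> = \<zero>\<^bsub>M\<^esub>"
proof -
  have "x \<cdot>\<^bsub>M\<^esub> \<zero>\<^bsub>R\<^esub> \<oplus>\<^bsub>M\<^esub> x \<cdot>\<^bsub>M\<^esub> \<zero>\<^bsub>R\<^esub> = x \<cdot>\<^bsub>M\<^esub> \<zero>\<^bsub>R\<^esub>"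
    using rsmult_add_right[of x "\<zero>\<^bsub>R\<^esub>" "\<zero>\<^bsub>R\<^esub>"] assms by simp
  then show ?thesis using assms rsmult_closed[of x "\<zero>\<^bsub>R\<^esub>"]
    by (metis M.add.r_cancel_one' R.zero_closed)
qed

lemma rsmult_zero_left:
  assumes "a \<in> carrier R"
  shows "\<zero>\<^bsub>M\<^esub> \<cdot>\<^bsub>M\<^esub> a = \<zero>\<^bsub>M\<^esub>"
  using rsmult_add_left[of "\<zero>\<^bsub>M\<^esub>" "\<zero>\<^bsub>M\<^esub>" a] rsmult_closed[of "\<zero>\<^bsub>M\<^esub>" a] assms
  by (metis M.add.r_cancel_one' M.zero_closed M.l_zero)

lemma rsmult_minus_one:
  assumes "x \<in> carrier M"
  shows "x \<cdot>\<^bsub>M\<^esub> (\<ominus>\<^bsub>R\<^esub> \<one>\<^bsub>R\<^esub>) = \<ominus>\<^bsub>M\<^esub> x"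
proof -
  have "x \<cdot>\<^bsub>M\<^esub> (\<ominus>\<^bsub>R\<^esub> \<one>\<^bsub>R\<^esub>) \<oplus>\<^bsub>M\<^esub> x = \<zero>\<^bsub>M\<^esub>"
    using rsmult_add_right[OF assms, of "\<ominus>\<^bsub>R\<^esub> \<one>\<^bsub>R\<^esub>" "\<one>\<^bsub>R\<^esub>"] assms
    by (simp add: R.l_neg rsmult_one rsmult_zero_right)
  then show ?thesis
    using M.minus_equality assms rsmult_closed[OF assms] R.a_inv_closed R.one_closed by metis
qed

text \<open>Closure under negatives comes for free, since -x is x times -1.\<close>

lemma rsubmodule_iff:
  "rsubmodule R M N \<longleftrightarrow> N \<subseteq> carrier M \<and> \<zero>\<^bsub>M\<^esub> \<in> N \<and>
     (\<forall>x\<in>N. \<forall>y\<in>N. x \<oplus>\<^bsub>M\<^esub> y \<in> N) \<and> (\<forall>x\<in>N. \<forall>a\<in>carrier R. x \<cdot>\<^bsub>M\<^esub> a \<in> N)"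
proof
  assume "rsubmodule R M N"
  then show "N \<subseteq> carrier M \<and> \<zero>\<^bsub>M\<^esub> \<in> N \<and>
     (\<forall>x\<in>N. \<forall>y\<in>N. x \<oplus>\<^bsub>M\<^esub> y \<in> N) \<and> (\<forall>x\<in>N. \<forall>a\<in>carrier R. x \<cdot>\<^bsub>M\<^esub> a \<in> N)"
    unfolding rsubmodule_def
    by (auto dest: additive_subgroup.a_subset[THEN subsetD] intro: additive_subgroup.zero_closed
        additive_subgroup.a_closed)
next
  assume N: "N \<subseteq> carrier M \<and> \<zero>\<^bsub>M\<^esub> \<in> N \<and>
     (\<forall>x\<in>N. \<forall>y\<in>N. x \<oplus>\<^bsub>M\<^esub> y \<in> N) \<and> (\<forall>x\<in>N. \<forall>a\<in>carrier R. x \<cdot>\<^bsub>M\<^esub> a \<in> N)"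
  have "\<ominus>\<^bsub>M\<^esub> x \<in> N" if "x \<in> N" for x
    using N that rsmult_minus_one[of x] R.a_inv_closed[OF R.one_closed]
    by (metis subsetD)
  then have "subgroup N (add_monoid M)"
    using N by (intro M.add.subgroupI) auto
  then show "rsubmodule R M N"
    using N by (auto simp: rsubmodule_def additive_subgroup_def)
qed

lemma rsubmoduleD:
  assumes "rsubmodule R M N"
  shows "N \<subseteq> carrier M" "\<zero>\<^bsub>M\<^esub> \<in> N"
    "\<And>x y. \<lbrakk>x \<in> N; y \<in> N\<rbrakk> \<Longrightarrow> x \<oplus>\<^bsub>M\<^esub> y \<in> N"
    "\<And>x a. \<lbrakk>x \<in> N; a \<in> carrier R\<rbrakk> \<Longrightarrow> x \<cdot>\<^bsub>M\<^esub> a \<in> N"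
    "\<And>x. x \<in> N \<Longrightarrow> \<ominus>\<^bsub>M\<^esub> x \<in> N"
  using assms unfolding rsubmodule_iff
  by (blast, blast, blast, blast, metis rsmult_minus_one R.a_inv_closed R.one_closed subsetD)

lemma rsubmodule_zero: "rsubmodule R M {\<zero>\<^bsub>M\<^esub>}"
  by (auto simp: rsubmodule_iff rsmult_zero_left)

lemma rsubmodule_carrier: "rsubmodule R M (carrier M)"
  by (auto simp: rsubmodule_iff rsmult_closed)

lemma rsubmodule_Int:
  "\<lbrakk>rsubmodule R M N; rsubmodule R M L\<rbrakk> \<Longrightarrow> rsubmodule R M (N \<inter> L)"
  by (auto simp: rsubmodule_iff)

lemma rsubmodule_set_add:
  assumes "rsubmodule R M N" "rsubmodule R M L"
  shows "rsubmodule R M (N <+>\<^bsub>M\<^esub> L)"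
proof -
  note N = rsubmoduleD[OF assms(1)] and L = rsubmoduleD[OF assms(2)]
  show ?thesis unfolding rsubmodule_iff
  proof (intro conjI ballI)
    show "N <+>\<^bsub>M\<^esub> L \<subseteq> carrier M" using N(1) L(1) by (rule set_add_closed)
    show "\<zero>\<^bsub>M\<^esub> \<in> N <+>\<^bsub>M\<^esub> L" unfolding set_add_def'
      using N(2) L(2) by (auto intro!: bexI[of _ "\<zero>\<^bsub>M\<^esub>"])
  next
    fix u v assume "u \<in> N <+>\<^bsub>M\<^esub> L" "v \<in> N <+>\<^bsub>M\<^esub> L"
    then obtain x y x' y' where *: "x \<in> N" "y \<in> L" "x' \<in> N" "y' \<in> L"
      and uv: "u = x \<oplus>\<^bsub>M\<^esub> y" "v = x' \<oplus>\<^bsub>M\<^esub> y'"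
      unfolding set_add_def' by blast
    have "u \<oplus>\<^bsub>M\<^esub> v = (x \<oplus>\<^bsub>M\<^esub> x') \<oplus>\<^bsub>M\<^esub> (y \<oplus>\<^bsub>M\<^esub> y')"
      using * N(1) L(1) unfolding uv by (simp add: subset_iff M.a_ac)
    then show "u \<oplus>\<^bsub>M\<^esub> v \<in> N <+>\<^bsub>M\<^esub> L"
      using N(3)[OF *(1,3)] L(3)[OF *(2,4)] unfolding set_add_def' by blast
  next
    fix u a assume "u \<in> N <+>\<^bsub>M\<^esub> L" and a: "a \<in> carrier R"
    then obtain x y where *: "x \<in> N" "y \<in> L" and u: "u = x \<oplus>\<^bsub>M\<^esub> y"
      unfolding set_add_def' by blast
    have "u \<cdot>\<^bsub>M\<^esub> a = x \<cdot>\<^bsub>M\<^esub> a \<oplus>\<^bsub>M\<^esub> y \<cdot>\<^bsub>M\<^esub> a"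
      using * a N(1) L(1) unfolding u by (simp add: subset_iff rsmult_add_left)
    then show "u \<cdot>\<^bsub>M\<^esub> a \<in> N <+>\<^bsub>M\<^esub> L"
      using N(4)[OF *(1) a] L(4)[OF *(2) a] unfolding set_add_def' by blast
  qed
qed

lemma subset_set_add:
  assumes "rsubmodule R M N" "rsubmodule R M L"
  shows "N \<subseteq> N <+>\<^bsub>M\<^esub> L" "L \<subseteq> N <+>\<^bsub>M\<^esub> L"
proof -
  note N = rsubmoduleD[OF assms(1)] and L = rsubmoduleD[OF assms(2)]
  show "N \<subseteq> N <+>\<^bsub>M\<^esub> L"
  proof
    fix x assume x: "x \<in> N"
    then have "x = x \<oplus>\<^bsub>M\<^esub> \<zero>\<^bsub>M\<^esub>" using N(1) by (simp add: subset_iff)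
    then show "x \<in> N <+>\<^bsub>M\<^esub> L" using x L(2) unfolding set_add_def' by blast
  qed
  show "L \<subseteq> N <+>\<^bsub>M\<^esub> L"
  proof
    fix x assume x: "x \<in> L"
    then have "x = \<zero>\<^bsub>M\<^esub> \<oplus>\<^bsub>M\<^esub> x" using L(1) by (simp add: subset_iff)
    then show "x \<in> N <+>\<^bsub>M\<^esub> L" using x N(2) unfolding set_add_def' by blast
  qed
qed

section \<open>Finite generation\<close>

lemma rsubmodule_rspan:
  assumes "A \<subseteq> carrier M"
  shows "rsubmodule R M (rspan R M A)"
proof -
  have "rspan R M A \<subseteq> carrier M"
    using rsubmodule_carrier assms unfolding rspan_def by blast
  then show ?thesis unfolding rspan_def rsubmodule_iff by simp
qed

lemma rspan_superset: "A \<subseteq> rspan R M A"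
  by (auto simp: rspan_def)

lemma rspan_least: "\<lbrakk>rsubmodule R M N; A \<subseteq> N\<rbrakk> \<Longrightarrow> rspan R M A \<subseteq> N"
  by (auto simp: rspan_def)

lemma finitely_generated_rsubmodule:
  "finitely_generated R M N \<Longrightarrow> rsubmodule R M N"
  by (auto simp: finitely_generated_def rsubmodule_rspan)

text \<open>Together with the elimination rule below, this replaces spans by a universal property:
  every submodule containing the generators contains \<open>N\<close>. Images and preimages respect
  that form directly.\<close>

lemma finitely_generatedI:
  assumes "rsubmodule R M N" "finite A" "A \<subseteq> N"
    and "\<And>L. \<lbrakk>rsubmodule R M L; A \<subseteq> L\<rbrakk> \<Longrightarrow> N \<subseteq> L"
  shows "finitely_generated R M N"
proof -
  have A: "A \<subseteq> carrier M" using assms(1,3) rsubmoduleD(1) by blast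
  have "N = rspan R M A"
    using assms rspan_least rsubmodule_rspan[OF A] rspan_superset by (intro antisym) blast+
  then show ?thesis using A assms(2) by (auto simp: finitely_generated_def)
qed

lemma finitely_generatedE:
  assumes "finitely_generated R M N"
  obtains A where "finite A" "A \<subseteq> N" "\<forall>L. rsubmodule R M L \<longrightarrow> A \<subseteq> L \<longrightarrow> N \<subseteq> L"
proof -
  obtain A where "finite A" "N = rspan R M A"
    using assms unfolding finitely_generated_def by blast
  then show ?thesis using that[of A] rspan_superset[of A] rspan_least[of _ A] by simp
qed

lemma finitely_generated_zero: "finitely_generated R M {\<zero>\<^bsub>M\<^esub>}"
  by (rule finitely_generatedI[where A = "{}"]) (auto simp: rsubmodule_zero rsubmoduleD)

text \<open>N is an extension of (N + J)/J by N \<inter> J. The N-components \<open>p a\<close> of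
  generators of N + J generate N modulo J, and generators of N \<inter> J supply the rest.\<close>

lemma finitely_generated_of_set_add:
  assumes N: "rsubmodule R M N" and J: "rsubmodule R M J"
    and fg_add: "finitely_generated R M (N <+>\<^bsub>M\<^esub> J)" and fg_Int: "finitely_generated R M (N \<inter> J)"
  shows "finitely_generated R M N"
proof -
  obtain A where A: "finite A" "A \<subseteq> N <+>\<^bsub>M\<^esub> J"
    "\<forall>L. rsubmodule R M L \<longrightarrow> A \<subseteq> L \<longrightarrow> N <+>\<^bsub>M\<^esub> J \<subseteq> L"
    using fg_add by (rule finitely_generatedE)
  obtain D where D: "finite D" "D \<subseteq> N \<inter> J" "\<forall>L. rsubmodule R M L \<longrightarrow> D \<subseteq> L \<longrightarrow> N \<inter> J \<subseteq> L"
    using fg_Int by (rule finitely_generatedE)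
  have "\<forall>a\<in>A. \<exists>n j. n \<in> N \<and> j \<in> J \<and> a = n \<oplus>\<^bsub>M\<^esub> j"
    using A(2) unfolding set_add_def' by blast
  then obtain p q where pq: "\<And>a. a \<in> A \<Longrightarrow> p a \<in> N \<and> q a \<in> J \<and> a = p a \<oplus>\<^bsub>M\<^esub> q a"
    by metis
  show ?thesis
  proof (rule finitely_generatedI[OF N])
    show "finite (p ` A \<union> D)" using A(1) D(1) by simp
    show "p ` A \<union> D \<subseteq> N" using pq D(2) by auto
  next
    fix L assume L: "rsubmodule R M L" and sub: "p ` A \<union> D \<subseteq> L"
    \<comment> \<open>Cutting down to \<open>N\<close> is what puts the \<open>J\<close>-component
      \<open>j\<close> = x - l of an element x of \<open>N\<close> into N \<inter> J.\<close>
    define L' where "L' = L \<inter> N"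
    have L': "rsubmodule R M L'" unfolding L'_def by (rule rsubmodule_Int[OF L N])
    have "A \<subseteq> L' <+>\<^bsub>M\<^esub> J"
    proof
      fix a assume "a \<in> A"
      then have "a = p a \<oplus>\<^bsub>M\<^esub> q a" "p a \<in> L'" "q a \<in> J" using pq[of a] sub by (auto simp: L'_def)
      then show "a \<in> L' <+>\<^bsub>M\<^esub> J" unfolding set_add_def' by blast
    qed
    then have *: "N <+>\<^bsub>M\<^esub> J \<subseteq> L' <+>\<^bsub>M\<^esub> J" using A(3) rsubmodule_set_add[OF L' J] by blast
    show "N \<subseteq> L"
    proof
      fix x assume x: "x \<in> N"
      then have "x \<in> L' <+>\<^bsub>M\<^esub> J" using * subset_set_add(1)[OF N J] by auto
      then obtain l j where lj: "l \<in> L'" "j \<in> J" "x = l \<oplus>\<^bsub>M\<^esub> j"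
        unfolding set_add_def' by blast
      have c: "l \<in> carrier M" "j \<in> carrier M" "x \<in> carrier M"
        using lj x rsubmoduleD(1)[OF L'] rsubmoduleD(1)[OF J] rsubmoduleD(1)[OF N] by auto
      have "j = \<ominus>\<^bsub>M\<^esub> l \<oplus>\<^bsub>M\<^esub> x" using c lj by (simp add: M.r_neg1)
      moreover have "\<ominus>\<^bsub>M\<^esub> l \<in> N" using lj rsubmoduleD(5)[OF N] by (simp add: L'_def)
      ultimately have "j \<in> N" using x rsubmoduleD(3)[OF N] by simp
      then have "j \<in> L" using lj D(3) L sub by blast
      then show "x \<in> L" using lj rsubmoduleD(3)[OF L] by (simp add: L'_def)
    qed
  qed
qed

section \<open>Chains of submodules, noetherian modules and maximal counterexamples\<close>

lemma rsubmodule_Union_chain: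
  assumes "\<C> \<noteq> {}" "\<And>N. N \<in> \<C> \<Longrightarrow> rsubmodule R M N" "subset.chain UNIV \<C>"
  shows "rsubmodule R M (\<Union>\<C>)"
proof -
  have add: "x \<oplus>\<^bsub>M\<^esub> y \<in> \<Union>\<C>" if "x \<in> N" "N \<in> \<C>" "y \<in> L" "L \<in> \<C>" for x y N L
  proof -
    have "N \<subseteq> L \<or> L \<subseteq> N" using that assms(3) by (auto simp: subset_chain_def)
    then show ?thesis
    proof
      assume "N \<subseteq> L"
      then have "x \<oplus>\<^bsub>M\<^esub> y \<in> L" using that rsubmoduleD(3)[OF assms(2)[of L]] by auto
      then show ?thesis using that by auto
    next
      assume "L \<subseteq> N"
      then have "x \<oplus>\<^bsub>M\<^esub> y \<in> N" using that rsubmoduleD(3)[OF assms(2)[of N]] by auto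
      then show ?thesis using that by auto
    qed
  qed
  show ?thesis unfolding rsubmodule_iff
  proof (intro conjI ballI)
    show "\<Union>\<C> \<subseteq> carrier M" using rsubmoduleD(1)[OF assms(2)] by (rule Union_least)
    show "\<zero>\<^bsub>M\<^esub> \<in> \<Union>\<C>" using assms(1) rsubmoduleD(2)[OF assms(2)] by auto
    show "x \<oplus>\<^bsub>M\<^esub> y \<in> \<Union>\<C>" if "x \<in> \<Union>\<C>" "y \<in> \<Union>\<C>" for x y
      using that add by auto
    show "x \<cdot>\<^bsub>M\<^esub> a \<in> \<Union>\<C>" if "x \<in> \<Union>\<C>" "a \<in> carrier R" for x a
      using that rsubmoduleD(4)[OF assms(2)] by auto
  qed
qed

text \<open>Finitely many generators of the union already lie in a single member of the chain. This
  serves both the ascending chain condition and the application of Zorn's lemma.\<close>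

lemma finitely_generated_Union_chain:
  assumes "\<C> \<noteq> {}" "\<And>N. N \<in> \<C> \<Longrightarrow> rsubmodule R M N" "subset.chain UNIV \<C>"
    and fg: "finitely_generated R M (\<Union>\<C>)"
  shows "\<Union>\<C> \<in> \<C>"
proof -
  obtain A where A: "finite A" "A \<subseteq> \<Union>\<C>" "\<forall>L. rsubmodule R M L \<longrightarrow> A \<subseteq> L \<longrightarrow> \<Union>\<C> \<subseteq> L"
    using fg by (rule finitely_generatedE)
  obtain N where "N \<in> \<C>" "A \<subseteq> N"
    using finite_subset_Union_chain[OF A(1,2) assms(1,3)] by blast
  then have "\<Union>\<C> = N" using A(3) assms(2) by blast
  then show ?thesis using \<open>N \<in> \<C>\<close> by simp
qed

text \<open>In a submodule that is not finitely generated one can always pick an element outside the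
  span of those picked so far, and these spans never become stationary. Conversely, the union of an
  ascending chain is finitely generated, hence attained.\<close>

lemma noetherian_iff_finitely_generated:
  "noetherian_rmodule R M \<longleftrightarrow> (\<forall>N. rsubmodule R M N \<longrightarrow> finitely_generated R M N)"
proof
  assume noeth: "noetherian_rmodule R M"
  show "\<forall>N. rsubmodule R M N \<longrightarrow> finitely_generated R M N"
  proof (intro allI impI, rule ccontr)
    fix N assume N: "rsubmodule R M N" and nfg: "\<not> finitely_generated R M N"
    define P where "P A \<longleftrightarrow> finite A \<and> A \<subseteq> N" for A
    have "\<exists>x. x \<in> N \<and> x \<notin> rspan R M A" if "P A" for A
    proof (rule ccontr)
      assume "\<nexists>x. x \<in> N \<and> x \<notin> rspan R M A"
      then have N_eq: "N = rspan R M A" using that rspan_least[OF N, of A] unfolding P_def by auto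
      have "finite A" "A \<subseteq> carrier M" using that rsubmoduleD(1)[OF N] unfolding P_def by auto
      then have "finitely_generated R M N"
        unfolding finitely_generated_def by (intro exI[of _ A] conjI N_eq)
      with nfg show False by simp
    qed
    then obtain x where x: "\<And>A. P A \<Longrightarrow> x A \<in> N \<and> x A \<notin> rspan R M A" by metis
    define F where "F n = ((\<lambda>A. insert (x A) A) ^^ n) {}" for n
    have F0: "F 0 = {}" and FS: "F (Suc n) = insert (x (F n)) (F n)" for n
      by (simp_all add: F_def)
    have PF: "P (F n)" for n
    proof (induction n)
      case 0
      show ?case by (simp add: F0 P_def)
    next
      case (Suc n)
      then show ?case using x[OF Suc] by (simp add: FS P_def)
    qed
    have Fc: "F n \<subseteq> carrier M" for n using PF[of n] rsubmoduleD(1)[OF N] unfolding P_def by auto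
    have sub: "rsubmodule R M (rspan R M (F n))" for n by (rule rsubmodule_rspan[OF Fc])
    have "rspan R M (F n) \<subseteq> rspan R M (F (Suc n))" for n
      by (rule rspan_least[OF sub]) (use rspan_superset[of "F (Suc n)"] FS in auto)
    then have "\<exists>n. \<forall>i\<ge>n. rspan R M (F i) = rspan R M (F n)"
      using noeth sub unfolding noetherian_rmodule_def by simp
    then obtain n where n: "\<And>i. i \<ge> n \<Longrightarrow> rspan R M (F i) = rspan R M (F n)" by auto
    have "x (F n) \<in> rspan R M (F (Suc n))" using FS rspan_superset[of "F (Suc n)"] by auto
    then show False using n[of "Suc n"] x[OF PF] by auto
  qed
next
  assume fg: "\<forall>N. rsubmodule R M N \<longrightarrow> finitely_generated R M N"
  show "noetherian_rmodule R M" unfolding noetherian_rmodule_def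
  proof (intro conjI allI impI right_module_axioms)
    fix C :: "nat \<Rightarrow> _" assume C: "(\<forall>i. rsubmodule R M (C i)) \<and> (\<forall>i. C i \<subseteq> C (Suc i))"
    then have Suc: "C i \<subseteq> C (Suc i)" for i by simp
    have mono: "C i \<subseteq> C j" if "i \<le> j" for i j
      by (rule lift_Suc_mono_le[of C, OF Suc that])
    have "subset.chain UNIV (range C)"
      unfolding subset_chain_def
    proof (intro conjI subset_UNIV ballI)
      fix A B assume "A \<in> range C" "B \<in> range C"
      then obtain i j where "A = C i" "B = C j" by auto
      then show "A \<subseteq> B \<or> B \<subseteq> A" using mono nat_le_linear[of i j] by auto
    qed
    moreover have sub: "N \<in> range C \<Longrightarrow> rsubmodule R M N" for N using C by auto
    ultimately have "\<Union>(range C) \<in> range C"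
      using fg rsubmodule_Union_chain[of "range C"] by (intro finitely_generated_Union_chain) simp_all
    then obtain n where n: "\<Union>(range C) = C n" by auto
    have "C i = C n" if "i \<ge> n" for i
      using mono[OF that] n by (intro antisym) auto
    then show "\<exists>n. \<forall>i\<ge>n. C i = C n" by auto
  qed
qed

text \<open>Zorn's lemma applies: if the union of a nonempty chain of such submodules were finitely
  generated, it would be a member of the chain.\<close>

lemma exists_maximal_not_finitely_generated:
  assumes "rsubmodule R M N" "\<not> finitely_generated R M N"
  obtains P where "rsubmodule R M P" "\<not> finitely_generated R M P"
    "\<forall>L. rsubmodule R M L \<longrightarrow> P \<subset> L \<longrightarrow> finitely_generated R M L"
proof -
  define \<A> where "\<A> = {P. rsubmodule R M P \<and> \<not> finitely_generated R M P}"
  have "\<exists>P\<in>\<A>. \<forall>L\<in>\<A>. P \<subseteq> L \<longrightarrow> L = P"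
  proof (rule subset_Zorn_nonempty)
    show "\<A> \<noteq> {}" using assms by (auto simp: \<A>_def)
    fix \<C> assume ne: "\<C> \<noteq> {}" and ch: "subset.chain \<A> \<C>"
    have "subset.chain UNIV \<C>" and sub: "\<C> \<subseteq> \<A>" using ch by (auto simp: subset_chain_def)
    then show "\<Union>\<C> \<in> \<A>"
      using rsubmodule_Union_chain[of \<C>] finitely_generated_Union_chain[of \<C>] ne
      unfolding \<A>_def by (metis (mono_tags, lifting) mem_Collect_eq subsetD)
  qed
  then obtain P where "P \<in> \<A>" "\<forall>L\<in>\<A>. P \<subseteq> L \<longrightarrow> L = P" ..
  then show ?thesis using that[of P] unfolding \<A>_def by auto
qed

lemma essential_maximal_not_finitely_generated:
  assumes P: "rsubmodule R M P" "\<not> finitely_generated R M P"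
    and max: "\<And>L. \<lbrakk>rsubmodule R M L; P \<subset> L\<rbrakk> \<Longrightarrow> finitely_generated R M L"
  shows "essential_submodule R M P"
  unfolding essential_submodule_def
proof (intro conjI P allI impI notI)
  fix L assume L: "rsubmodule R M L \<and> L \<noteq> {\<zero>\<^bsub>M\<^esub>}" and Int: "P \<inter> L = {\<zero>\<^bsub>M\<^esub>}"
  have "P \<subset> P <+>\<^bsub>M\<^esub> L"
    using subset_set_add[OF P(1), of L] L Int rsubmoduleD(2)[of L] by blast
  then have "finitely_generated R M (P <+>\<^bsub>M\<^esub> L)"
    using max rsubmodule_set_add P(1) L by blast
  then show False
    using finitely_generated_of_set_add[OF P(1), of L] L P(2) Int finitely_generated_zero by simp
qed

section \<open>Subfactors and homomorphisms defined on a submodule\<close>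

lemma right_module_restrict:
  assumes N: "rsubmodule R M N"
  shows "right_module R (M\<lparr>carrier := N\<rparr>)"
proof -
  note D = rsubmoduleD[OF N]
  have "abelian_group (M\<lparr>carrier := N\<rparr>)"
  proof (rule abelian_groupI)
    fix x assume "x \<in> carrier (M\<lparr>carrier := N\<rparr>)"
    then show "\<exists>y\<in>carrier (M\<lparr>carrier := N\<rparr>). y \<oplus>\<^bsub>M\<lparr>carrier := N\<rparr>\<^esub> x = \<zero>\<^bsub>M\<lparr>carrier := N\<rparr>\<^esub>"
      using D by (auto intro!: bexI[of _ "\<ominus>\<^bsub>M\<^esub> x"] M.l_neg)
  qed (use D in \<open>auto simp: subset_iff M.a_ac\<close>)
  then show ?thesis
    by (intro right_module.intro right_module_axioms.intro R.ring_axioms)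
      (use D in \<open>auto simp: subset_iff rsmult_add_left rsmult_add_right rsmult_assoc rsmult_one\<close>)
qed

lemma rsubmodule_restrict_iff:
  assumes N: "rsubmodule R M N"
  shows "rsubmodule R (M\<lparr>carrier := N\<rparr>) L \<longleftrightarrow> rsubmodule R M L \<and> L \<subseteq> N"
  using right_module.rsubmodule_iff[OF right_module_restrict[OF N]] rsubmodule_iff rsubmoduleD(1)[OF N]
  by auto

lemma coset_rep_eq_zero_iff:
  assumes N: "rsubmodule R M N" and x: "x \<in> carrier M"
  shows "coset_rep M N x = coset_rep M N \<zero>\<^bsub>M\<^esub> \<longleftrightarrow> x \<in> N"
proof -
  interpret N: abelian_subgroup N M
    using N by (simp add: rsubmodule_def abelian_subgroupI3 M.abelian_group_axioms)
  have "coset_rep M N x = coset_rep M N \<zero>\<^bsub>M\<^esub> \<longleftrightarrow> N +>\<^bsub>M\<^esub> x = N +>\<^bsub>M\<^esub> \<zero>\<^bsub>M\<^esub>"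
    using coset_rep_eq_iff[OF N x] by simp
  also have "\<dots> \<longleftrightarrow> x \<in> N"
    using N.a_rcos_self[OF x] N.a_rcos_const[of x] M.a_coset_add_zero[OF N.a_subset] by auto
  finally show ?thesis .
qed

end
text \<open>The domain is a submodule \<open>J\<close> of an ambient \<open>P\<close>, not a module
  of its own. Passing to a subfactor of the target then changes only \<open>J\<close> and the
  kernel, so everything stays in the one lattice of submodules of \<open>P\<close>.\<close>

locale submodule_hom = P: right_module R P + M: right_module R M
  for R :: "('a, 'c) ring_scheme" and P :: "('a, 'p) rmodule" and M :: "('a, 'm) rmodule" +
  fixes J :: "'p set" and \<phi> :: "'p \<Rightarrow> 'm"
  assumes dom: "rsubmodule R P J"
    and closed: "x \<in> J \<Longrightarrow> \<phi> x \<in> carrier M"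
    and map_add: "\<lbrakk>x \<in> J; y \<in> J\<rbrakk> \<Longrightarrow> \<phi> (x \<oplus>\<^bsub>P\<^esub> y) = \<phi> x \<oplus>\<^bsub>M\<^esub> \<phi> y"
    and map_smult: "\<lbrakk>x \<in> J; a \<in> carrier R\<rbrakk> \<Longrightarrow> \<phi> (x \<cdot>\<^bsub>P\<^esub> a) = \<phi> x \<cdot>\<^bsub>M\<^esub> a"
begin

definition ker :: "'p set" where
  "ker = {x \<in> J. \<phi> x = \<zero>\<^bsub>M\<^esub>}"

lemmas domD = P.rsubmoduleD[OF dom]

lemma map_zero: "\<phi> \<zero>\<^bsub>P\<^esub> = \<zero>\<^bsub>M\<^esub>"
  using map_smult[of "\<zero>\<^bsub>P\<^esub>" "\<zero>\<^bsub>R\<^esub>"] domD(2) closed[of "\<zero>\<^bsub>P\<^esub>"]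
  by (simp add: P.rsmult_zero_right M.rsmult_zero_right)

lemma rsubmodule_image:
  assumes K: "rsubmodule R P K" "K \<subseteq> J"
  shows "rsubmodule R M (\<phi> ` K)"
proof -
  note KD = P.rsubmoduleD[OF K(1)]
  have "\<phi> x \<oplus>\<^bsub>M\<^esub> \<phi> y \<in> \<phi> ` K" if "x \<in> K" "y \<in> K" for x y
    using that K(2) KD(3)[OF that] map_add[of x y] by (metis imageI subsetD)
  moreover have "\<phi> x \<cdot>\<^bsub>M\<^esub> a \<in> \<phi> ` K" if "x \<in> K" "a \<in> carrier R" for x a
    using that K(2) KD(4)[OF that] map_smult[of x a] by (metis imageI subsetD)
  moreover have "\<zero>\<^bsub>M\<^esub> \<in> \<phi> ` K" using KD(2) map_zero by (metis imageI)
  ultimately show ?thesis unfolding M.rsubmodule_iff using K(2) closed by auto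
qed

lemma rsubmodule_vimage:
  assumes N: "rsubmodule R M N"
  shows "rsubmodule R P {x \<in> J. \<phi> x \<in> N}"
  using domD M.rsubmoduleD[OF N] map_zero
  unfolding P.rsubmodule_iff by (auto simp: map_add map_smult)

lemma image_vimage:
  assumes "N \<subseteq> \<phi> ` J"
  shows "\<phi> ` {x \<in> J. \<phi> x \<in> N} = N"
  using assms by auto

text \<open>If \<phi> x = \<phi> k with k in \<open>K\<close>, then x - k lies in the kernel, hence
  in \<open>K\<close>.\<close>

lemma vimage_image:
  assumes K: "rsubmodule R P K" "ker \<subseteq> K" "K \<subseteq> J" and x: "x \<in> J" "\<phi> x \<in> \<phi> ` K"
  shows "x \<in> K"
proof -
  note KD = P.rsubmoduleD[OF K(1)]
  obtain k where k: "k \<in> K" "\<phi> x = \<phi> k" using x(2) by auto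
  have c: "x \<in> carrier P" "k \<in> carrier P" "k \<in> J" using x k KD(1) K(3) domD(1) by auto
  \<comment> \<open>The negative of \<open>k\<close> is written as a multiple of \<open>k\<close>,
    so that \<open>map_smult\<close> computes its image.\<close>
  define m where "m = k \<cdot>\<^bsub>P\<^esub> (\<ominus>\<^bsub>R\<^esub> \<one>\<^bsub>R\<^esub>)"
  have "m \<in> K" unfolding m_def using KD(4) k by simp
  then have m: "m = \<ominus>\<^bsub>P\<^esub> k" "m \<in> K" "m \<in> J"
    unfolding m_def using P.rsmult_minus_one[OF c(2)] K(3) by auto
  have "\<phi> (x \<oplus>\<^bsub>P\<^esub> m) = \<phi> k \<oplus>\<^bsub>M\<^esub> \<phi> k \<cdot>\<^bsub>M\<^esub> (\<ominus>\<^bsub>R\<^esub> \<one>\<^bsub>R\<^esub>)"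
    using map_add[OF x(1) m(3)] map_smult[OF c(3), of "\<ominus>\<^bsub>R\<^esub> \<one>\<^bsub>R\<^esub>"] k by (simp add: m_def)
  also have "\<dots> = \<zero>\<^bsub>M\<^esub>" using M.rsmult_minus_one closed[OF c(3)] by (simp add: M.M.r_neg)
  finally have "x \<oplus>\<^bsub>P\<^esub> m \<in> K" using K(2) domD(3)[OF x(1) m(3)] unfolding ker_def by auto
  then have "(x \<oplus>\<^bsub>P\<^esub> m) \<oplus>\<^bsub>P\<^esub> k \<in> K" using KD(3) k by simp
  moreover have "(x \<oplus>\<^bsub>P\<^esub> m) \<oplus>\<^bsub>P\<^esub> k = x"
    using c by (simp add: m P.M.a_assoc P.M.l_neg)
  ultimately show ?thesis by simp
qed

lemma finitely_generated_image:
  assumes fg: "finitely_generated R P K" and K: "K \<subseteq> J"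
  shows "finitely_generated R M (\<phi> ` K)"
proof -
  obtain A where A: "finite A" "A \<subseteq> K" "\<forall>L. rsubmodule R P L \<longrightarrow> A \<subseteq> L \<longrightarrow> K \<subseteq> L"
    using fg by (rule P.finitely_generatedE)
  show ?thesis
  proof (rule M.finitely_generatedI)
    show "rsubmodule R M (\<phi> ` K)"
      using rsubmodule_image P.finitely_generated_rsubmodule[OF fg] K by simp
    show "finite (\<phi> ` A)" "\<phi> ` A \<subseteq> \<phi> ` K" using A by auto
  next
    fix L assume L: "rsubmodule R M L" "\<phi> ` A \<subseteq> L"
    have "A \<subseteq> {x \<in> J. \<phi> x \<in> L}" using A(2) L(2) K by auto
    then have "K \<subseteq> {x \<in> J. \<phi> x \<in> L}" using A(3) rsubmodule_vimage[OF L(1)] by simp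
    then show "\<phi> ` K \<subseteq> L" by auto
  qed
qed

text \<open>The map is \<phi> on \<open>K\<close> followed by the projection modulo the image of
  \<open>L\<close>. With the kernel computed below, it presents the subfactor of \<open>M\<close> by
  the interval [L, K] of \<open>P\<close>.\<close>

lemma submodule_hom_subfactor:
  assumes K: "rsubmodule R P K" "K \<subseteq> J" and L: "rsubmodule R P L" "L \<subseteq> K"
  shows "submodule_hom R P (rquot (M\<lparr>carrier := \<phi> ` K\<rparr>) (\<phi> ` L)) K
    (\<lambda>x. coset_rep (M\<lparr>carrier := \<phi> ` K\<rparr>) (\<phi> ` L) (\<phi> x))"
proof -
  interpret K: right_module R "M\<lparr>carrier := \<phi> ` K\<rparr>"
    using M.right_module_restrict rsubmodule_image[OF K] .
  have L': "rsubmodule R (M\<lparr>carrier := \<phi> ` K\<rparr>) (\<phi> ` L)"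
    using M.rsubmodule_restrict_iff[OF rsubmodule_image[OF K]] rsubmodule_image[OF L(1)] K L by auto
  note h = K.rquot_hom[OF L']
  show ?thesis
  proof (intro submodule_hom.intro submodule_hom_axioms.intro)
    show "right_module R P" "rsubmodule R P K" by (rule P.right_module_axioms, rule K(1))
    show "right_module R (rquot (M\<lparr>carrier := \<phi> ` K\<rparr>) (\<phi> ` L))"
      by (rule K.right_module_rquot[OF L'])
  qed (use K(2) h(1) h(3,4)[symmetric] in \<open>auto simp: map_add map_smult subset_iff\<close>)
qed

lemma ker_subfactor:
  assumes K: "rsubmodule R P K" "K \<subseteq> J" and L: "rsubmodule R P L" "L \<subseteq> K" "ker \<subseteq> L"
  shows "submodule_hom.ker (rquot (M\<lparr>carrier := \<phi> ` K\<rparr>) (\<phi> ` L)) K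
    (\<lambda>x. coset_rep (M\<lparr>carrier := \<phi> ` K\<rparr>) (\<phi> ` L) (\<phi> x)) = L"
proof -
  interpret Q: submodule_hom R P "rquot (M\<lparr>carrier := \<phi> ` K\<rparr>) (\<phi> ` L)" K
    "\<lambda>x. coset_rep (M\<lparr>carrier := \<phi> ` K\<rparr>) (\<phi> ` L) (\<phi> x)"
    by (rule submodule_hom_subfactor[OF K L(1,2)])
  interpret K: right_module R "M\<lparr>carrier := \<phi> ` K\<rparr>"
    using M.right_module_restrict rsubmodule_image[OF K] .
  have L': "rsubmodule R (M\<lparr>carrier := \<phi> ` K\<rparr>) (\<phi> ` L)"
    using M.rsubmodule_restrict_iff[OF rsubmodule_image[OF K]] rsubmodule_image[OF L(1)] K L by auto
  have "\<phi> x \<in> \<phi> ` L \<longleftrightarrow> x \<in> L" if "x \<in> K" for x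
    using vimage_image[of L x] K L that by auto
  then show ?thesis
    using L(2) K.coset_rep_eq_zero_iff[OF L'] K.rquot_hom(2)[OF L'] unfolding Q.ker_def by auto
qed

end

section \<open>Deviation of intervals\<close>

text \<open>
  The classes \<open>\<K>\<^sub>\<alpha>\<close> in terms of intervals \<open>[I, J]\<close> of a family of sets: a subfactor of a
  subfactor is again an interval, so no quotient of a quotient has to be formed.
\<close>

inductive deviation_le :: "'x set set \<Rightarrow> 'b::wellorder option \<Rightarrow> 'x set \<Rightarrow> 'x set \<Rightarrow> bool"
  for \<L> :: "'x set set" where
  minus_one: "deviation_le \<L> None I I"
| ordinal: "(\<forall>C :: nat \<Rightarrow> 'x set.
     (\<forall>i. C i \<in> \<L> \<and> I \<subseteq> C i \<and> C i \<subseteq> J) \<and> (\<forall>i. C (Suc i) \<subseteq> C i) \<longrightarrow>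
     (\<exists>n. \<forall>i\<ge>n. \<exists>\<beta><Some \<alpha>. deviation_le \<L> \<beta> (C (Suc i)) (C i)))
   \<Longrightarrow> deviation_le \<L> (Some \<alpha>) I J"

lemma deviation_le_None_iff: "deviation_le \<L> None I J \<longleftrightarrow> I = J"
  by (auto elim: deviation_le.cases intro: deviation_le.intros)

lemma deviation_le_Some_iff: "deviation_le \<L> (Some \<alpha>) I J \<longleftrightarrow> (\<forall>C :: nat \<Rightarrow> 'x set.
     (\<forall>i. C i \<in> \<L> \<and> I \<subseteq> C i \<and> C i \<subseteq> J) \<and> (\<forall>i. C (Suc i) \<subseteq> C i) \<longrightarrow>
     (\<exists>n. \<forall>i\<ge>n. \<exists>\<beta><Some \<alpha>. deviation_le \<L> \<beta> (C (Suc i)) (C i)))"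
  by (subst deviation_le.simps) simp

text \<open>A chain in the smaller interval is a chain in the larger one, with the same factors.
  This takes the place of passing Krull dimension to submodules and quotients.\<close>

lemma deviation_le_subinterval:
  assumes "deviation_le \<L> \<alpha> I J" "I \<subseteq> I'" "I' \<subseteq> J'" "J' \<subseteq> J"
  shows "deviation_le \<L> \<alpha> I' J'"
proof (cases \<alpha>)
  case None
  then show ?thesis using assms by (auto simp: deviation_le_None_iff)
next
  case (Some a)
  show ?thesis unfolding Some deviation_le_Some_iff
  proof (intro allI impI)
    fix C :: "nat \<Rightarrow> 'a set"
    assume "(\<forall>i. C i \<in> \<L> \<and> I' \<subseteq> C i \<and> C i \<subseteq> J') \<and> (\<forall>i. C (Suc i) \<subseteq> C i)"
    then have "(\<forall>i. C i \<in> \<L> \<and> I \<subseteq> C i \<and> C i \<subseteq> J) \<and> (\<forall>i. C (Suc i) \<subseteq> C i)"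
      using assms by blast
    then show "\<exists>n. \<forall>i\<ge>n. \<exists>\<beta><Some a. deviation_le \<L> \<beta> (C (Suc i)) (C i)"
      using assms(1) unfolding Some deviation_le_Some_iff by blast
  qed
qed

section \<open>Existence of the deviation\<close>

lemma Well_order_less_eq: "Well_order {(x, y :: 'b::wellorder). x \<le> y}"
proof -
  have "{(x, y :: 'b). x \<le> y} - Id = {(x, y). x < y}" by auto
  moreover have "Field {(x, y :: 'b). x \<le> y} = UNIV" by (auto simp: Field_def)
  ultimately show ?thesis
    using wf
    by (auto simp: well_order_on_def linear_order_on_def partial_order_on_def preorder_on_def
        refl_on_def trans_def antisym_def total_on_def)
qed

text \<open>Well-orders are comparable, so it suffices to exclude both strict inequalities. Either
  one produces an ordinal below \<beta>, for which the induction hypothesis gives a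
  contradiction.\<close>

lemma rep_ordinal_ordIso_initial_segment:
  "(rep_ordinal \<beta>, {(x, y :: 'b ordinal). x \<le> y \<and> y < \<beta>}) \<in> ordIso"
proof (induction \<beta> rule: less_induct)
  case (less \<beta>)
  define seg where "seg \<gamma> = {(x, y :: 'b ordinal). x \<le> y \<and> y < \<gamma>}" for \<gamma>
  have IH: "(rep_ordinal \<gamma>, seg \<gamma>) \<in> ordIso" if "\<gamma> < \<beta>" for \<gamma>
    using less.IH[OF that] by (simp add: seg_def)
  have Field_seg: "Field (seg \<gamma>) = {..<\<gamma>}" for \<gamma> by (auto simp: seg_def Field_def)
  have "seg \<gamma> = Restr {(x, y). x \<le> y} {..<\<gamma>}" for \<gamma> by (auto simp: seg_def)
  then have wo: "Well_order (seg \<gamma>)" for \<gamma>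
    using Well_order_Restr[OF Well_order_less_eq] by metis
  have seg_Restr: "Restr (seg \<beta>) (underS (seg \<beta>) \<gamma>) = seg \<gamma>" if "\<gamma> < \<beta>" for \<gamma>
    using that by (auto simp: seg_def underS_def)
  have refl: "(rep_ordinal \<gamma>, rep_ordinal \<gamma>) \<in> ordIso" for \<gamma> :: "'b ordinal"
    using Quotient3_rep_reflp[OF Quotient3_ordinal] .
  have wo_rep: "Well_order (rep_ordinal \<beta>)" using refl by (simp add: ordIso_def)
  have "(rep_ordinal \<beta>, seg \<beta>) \<notin> ordLess"
  proof
    assume "(rep_ordinal \<beta>, seg \<beta>) \<in> ordLess"
    then obtain \<gamma> where "\<gamma> < \<beta>" "(rep_ordinal \<beta>, seg \<gamma>) \<in> ordIso"
      using ordLess_iff_ordIso_Restr[OF wo wo_rep, of \<beta>] seg_Restr by (auto simp: Field_seg)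
    then have "(rep_ordinal \<beta>, rep_ordinal \<gamma>) \<in> ordIso"
      using IH ordIso_symmetric ordIso_transitive by blast
    then have "\<beta> = \<gamma>" by (rule Quotient3_rel_rep[OF Quotient3_ordinal, THEN iffD1])
    then show False using \<open>\<gamma> < \<beta>\<close> by simp
  qed
  moreover have "(seg \<beta>, rep_ordinal \<beta>) \<notin> ordLess"
  proof
    assume less': "(seg \<beta>, rep_ordinal \<beta>) \<in> ordLess"
    \<comment> \<open>\<open>seg \<beta>\<close> is a relation on ordinals, not on
      \<open>'b\<close>. Being shorter than \<open>rep_ordinal \<beta>\<close>, it has a copy
      \<open>s\<close> on \<open>'b\<close>, which represents an ordinal of the same type.\<close>
    then obtain s :: "'b rel" where s: "(seg \<beta>, s) \<in> ordIso"
      using ordLess_iff_ordIso_Restr[OF wo_rep wo] by blast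
    define \<delta> where "\<delta> = abs_ordinal s"
    have "(s, s) \<in> ordIso" using s ordIso_symmetric ordIso_transitive by blast
    then have "(rep_ordinal \<delta>, s) \<in> ordIso"
      unfolding \<delta>_def by (rule Quotient3_rep_abs[OF Quotient3_ordinal])
    then have \<delta>: "(rep_ordinal \<delta>, seg \<beta>) \<in> ordIso"
      using s ordIso_symmetric ordIso_transitive by blast
    then have "(rep_ordinal \<delta>, rep_ordinal \<beta>) \<in> ordLess"
      using less' ordIso_ordLess_trans by blast
    then have "\<delta> < \<beta>" by (simp add: less_ordinal.rep_eq)
    then have "(seg \<delta>, seg \<beta>) \<in> ordLess"
      using underS_Restr_ordLess[OF wo, of \<beta> \<delta>] seg_Restr Field_seg[of \<beta>] by force
    then have "(rep_ordinal \<delta>, seg \<beta>) \<in> ordLess"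
      using IH[OF \<open>\<delta> < \<beta>\<close>] ordIso_ordLess_trans by blast
    then show False using \<delta> not_ordLess_ordIso by blast
  qed
  ultimately show ?case
    using wo wo_rep ordLess_or_ordLeq ordLeq_iff_ordLess_or_ordIso unfolding seg_def[symmetric] by blast
qed

text \<open>This is the Burali-Forti argument: a surjection would let the order of all ordinals be
  copied onto a subset of \<open>'b\<close>, so that it would be represented by some \<alpha> of the
  type and be isomorphic to its own proper initial segment below \<alpha>.\<close>

lemma no_surj_ordinal: "\<not> surj (f :: 'b \<Rightarrow> 'b ordinal)"
proof
  assume "surj f"
  then have inj: "inj (inv_into UNIV f)" by (rule surj_imp_inj_inv)
  let ?le = "{(x, y :: 'b ordinal). x \<le> y}"
  define r where "r = dir_image ?le (inv_into UNIV f)"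
  have iso: "(?le, r) \<in> ordIso" unfolding r_def
    by (rule dir_image_ordIso[OF Well_order_less_eq]) (rule inj_on_subset[OF inj subset_UNIV])
  define \<alpha> where "\<alpha> = abs_ordinal r"
  have "(r, r) \<in> ordIso" by (rule ordIso_transitive[OF ordIso_symmetric[OF iso] iso])
  then have "(rep_ordinal \<alpha>, r) \<in> ordIso"
    unfolding \<alpha>_def by (rule Quotient3_rep_abs[OF Quotient3_ordinal])
  then have "(rep_ordinal \<alpha>, ?le) \<in> ordIso"
    by (rule ordIso_transitive[OF _ ordIso_symmetric[OF iso]])
  then have "({(x, y). x \<le> y \<and> y < \<alpha>}, ?le) \<in> ordIso"
    by (rule ordIso_transitive[OF ordIso_symmetric[OF rep_ordinal_ordIso_initial_segment]])
  moreover have "{(x, y). x \<le> y \<and> y < \<alpha>} = Restr ?le (underS ?le \<alpha>)"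
    by (auto simp: underS_def)
  moreover have "Field ?le \<noteq> {}" by (auto simp: Field_def)
  ultimately show False
    using underS_Restr_ordLess[OF Well_order_less_eq, of \<alpha>] not_ordLess_ordIso by auto
qed

text \<open>Composing \<open>f\<close> with an inverse of \<open>g\<close> would give a surjection
  from \<open>'b\<close>. The arbitrary values of that inverse outside the image of \<open>g\<close>
  do not harm surjectivity.\<close>

lemma image_neq_UNIV_ordinal:
  fixes f :: "'x \<Rightarrow> 'b ordinal" and g :: "'x \<Rightarrow> 'b"
  assumes "inj_on g X"
  shows "f ` X \<noteq> UNIV"
proof
  assume UNIV: "f ` X = UNIV"
  have "surj (\<lambda>b. f (inv_into X g b))"
  proof (rule surjI)
    fix \<alpha>
    define x where "x = inv_into X f \<alpha>"
    have x: "x \<in> X" "f x = \<alpha>" unfolding x_def using UNIV by (simp_all add: inv_into_into f_inv_into_f)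
    show "f (inv_into X g (g (inv_into X f \<alpha>))) = \<alpha>"
      using x inv_into_f_f[OF assms] by (simp add: x_def)
  qed
  then show False by (rule notE[OF no_surj_ordinal])
qed

text \<open>
  The deviation of \<open>[K, J]\<close> is bounded by the rank of \<open>K\<close> for reverse inclusion.  The ranks of
  the elements above \<open>K\<close> form an initial segment, so the rank of \<open>K\<close> is the least
  ordinal missing from it, and a counting argument shows that one is missing.
\<close>

lemma exists_deviation_le:
  fixes g :: "'x set \<Rightarrow> 'b"
  defines "\<X> \<equiv> \<lambda>\<L> I J. {K \<in> \<L>. I \<subseteq> K \<and> K \<subseteq> J}"
  assumes inj: "inj_on g (\<X> \<L> I J)" and I: "I \<in> \<X> \<L> I J"
    and acc: "wf {(K', K). K \<in> \<X> \<L> I J \<and> K' \<in> \<X> \<L> I J \<and> K \<subset> K'}"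
  shows "\<exists>\<alpha> :: 'b ordinal option. deviation_le \<L> \<alpha> I J"
proof -
  define X where "X = \<X> \<L> I J"
  define above where "above K = {K' \<in> X. K \<subset> K'}" for K
  define rk :: "'x set \<Rightarrow> 'b ordinal" where
    "rk = wfrec {(K', K). K \<in> X \<and> K' \<in> X \<and> K \<subset> K'} (\<lambda>f K. LEAST \<gamma>. \<gamma> \<notin> f ` above K)"
  have rk_eq: "rk K = (LEAST \<gamma>. \<gamma> \<notin> rk ` above K)" if "K \<in> X" for K
  proof -
    \<comment> \<open>Every element of \<open>above K\<close> precedes \<open>K\<close> in the
      well-founded relation, so \<open>cut\<close> leaves the relevant values alone.\<close>
    have "cut rk {(K', K). K \<in> X \<and> K' \<in> X \<and> K \<subset> K'} K ` above K = rk ` above K"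
      using that by (intro image_cong) (auto simp: above_def cut_def)
    then show ?thesis
      using wfrec[OF acc[folded X_def], of "\<lambda>(f :: _ \<Rightarrow> 'b ordinal) K. LEAST \<gamma>. \<gamma> \<notin> f ` above K" K]
      by (simp add: rk_def)
  qed
  have fresh: "rk K \<notin> rk ` above K" if "K \<in> X" for K
  proof -
    \<comment> \<open>\<open>g\<close> embeds \<open>above K\<close> into \<open>'b\<close>, so the
      ranks above \<open>K\<close> cannot exhaust \<open>'b ordinal\<close>, and the
      \<open>LEAST\<close> ranges over a nonempty set.\<close>
    have "inj_on g (above K)" using inj by (rule inj_on_subset) (auto simp: above_def X_def)
    then have "\<exists>\<gamma>. \<gamma> \<notin> rk ` above K" using image_neq_UNIV_ordinal[of g "above K" rk] by blast
    then show ?thesis unfolding rk_eq[OF that] by (rule LeastI_ex)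
  qed
  have rk_less: "rk K' < rk K" if "K \<in> X" "K' \<in> above K" for K K'
  proof (rule ccontr)
    assume "\<not> rk K' < rk K"
    moreover have "rk K' \<noteq> rk K" using fresh[OF that(1)] imageI[OF that(2), of rk] by auto
    ultimately have "rk K < rk K'" by simp
    moreover have "K' \<in> X" using that(2) by (simp add: above_def)
    \<comment> \<open>\<open>rk K'\<close> is the least ordinal missing above K', so the smaller
      \<open>rk K\<close> is attained there.\<close>
    ultimately have "rk K \<in> rk ` above K'"
      using rk_eq[of K'] not_less_Least[of "rk K" "\<lambda>\<gamma>. \<gamma> \<notin> rk ` above K'"] by simp
    moreover have "above K' \<subseteq> above K" using that(2) by (auto simp: above_def)
    ultimately show False using fresh[OF that(1)] by auto
  qed
  have "deviation_le \<L> (Some (rk K)) K J" if "K \<in> X" for K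
    using acc[folded X_def] that
  proof (induction K rule: wf_induct_rule)
    case (less K)
    show ?case unfolding deviation_le_Some_iff
    proof (intro allI impI)
      fix C :: "nat \<Rightarrow> 'x set"
      assume C: "(\<forall>i. C i \<in> \<L> \<and> K \<subseteq> C i \<and> C i \<subseteq> J) \<and> (\<forall>i. C (Suc i) \<subseteq> C i)"
      have "C i \<in> \<L>" "K \<subseteq> C i" "C i \<subseteq> J" for i using C by simp_all
      then have CX: "C i \<in> X" for i
        using less.prems order_trans[of I K "C i"] unfolding X_def \<X>_def by simp
      show "\<exists>n. \<forall>i\<ge>n. \<exists>\<beta><Some (rk K). deviation_le \<L> \<beta> (C (Suc i)) (C i)"
      \<comment> \<open>A chain that reaches \<open>K\<close> stays there and has trivial factors
        from then on. Otherwise every term lies strictly above \<open>K\<close> and has smaller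
        rank, which bounds the factor above it.\<close>
      proof (cases "\<exists>n. C n = K")
        case True
        then obtain n where n: "C n = K" by auto
        have "C i = K" if "i \<ge> n" for i
          using that
        proof (induction i rule: dec_induct)
          case (step i)
          then show ?case using C by (metis antisym)
        qed (rule n)
        then show ?thesis
          by (intro exI[of _ n] allI impI exI[of _ None]) (simp add: deviation_le_None_iff)
      next
        case False
        have "\<exists>\<beta><Some (rk K). deviation_le \<L> \<beta> (C (Suc i)) (C i)" for i
        proof -
          have sub: "K \<subset> C (Suc i)" using C False by (metis psubsetI)
          then have "deviation_le \<L> (Some (rk (C (Suc i)))) (C (Suc i)) J"
            using less.IH[of "C (Suc i)"] less.prems CX[of "Suc i"] by simp
          then have "deviation_le \<L> (Some (rk (C (Suc i)))) (C (Suc i)) (C i)"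
            by (rule deviation_le_subinterval) (use C in simp_all)
          moreover have "rk (C (Suc i)) < rk K"
            using sub CX less.prems by (intro rk_less) (simp_all add: above_def)
          ultimately show ?thesis by (intro exI[of _ "Some (rk (C (Suc i)))"]) simp
        qed
        then show ?thesis by simp
      qed
    qed
  qed
  then show ?thesis using I X_def by auto
qed


section \<open>Krull dimension as the deviation of an interval\<close>

lemma krull_class_None_iff: "krull_class R None M \<longleftrightarrow> right_module R M \<and> zero_rmodule M"
  by (subst krull_class.simps) simp

lemma krull_class_Some_iff: "krull_class R (Some \<alpha>) M \<longleftrightarrow> right_module R M \<and>
     (\<forall>C. (\<forall>i. rsubmodule R M (C i)) \<and> (\<forall>i. C (Suc i) \<subseteq> C i) \<longrightarrow>
       (\<exists>n. \<forall>i\<ge>n. \<exists>\<beta><Some \<alpha>. krull_class R \<beta> (rquot (M\<lparr>carrier := C i\<rparr>) (C (Suc i)))))"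
  by (subst krull_class.simps) simp

text \<open>Image and preimage under \<phi> match chains in \<open>M\<close> with chains in the
  interval. Allowing an arbitrary surjection is what carries the induction: each factor of a chain
  is again the image of a submodule of the same \<open>P\<close>, now with the next term as
  kernel.\<close>

lemma krull_class_iff_deviation_le:
  assumes "submodule_hom R P M J \<phi>" "\<phi> ` J = carrier M"
  shows "krull_class R \<alpha> M \<longleftrightarrow>
    deviation_le {N. rsubmodule R P N} \<alpha> (submodule_hom.ker M J \<phi>) J"
  using assms
proof (induction \<alpha> arbitrary: M J \<phi> rule: less_induct)
  case (less \<alpha>)
  interpret submodule_hom R P M J \<phi> by (rule less.prems(1))
  note surj = less.prems(2)
  have factor: "krull_class R \<beta> (rquot (M\<lparr>carrier := \<phi> ` K\<rparr>) (\<phi> ` L)) \<longleftrightarrow>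
      deviation_le {N. rsubmodule R P N} \<beta> L K"
    if "\<beta> < \<alpha>" and K: "rsubmodule R P K" "K \<subseteq> J" and L: "rsubmodule R P L" "L \<subseteq> K" "ker \<subseteq> L"
    for \<beta> K L
  proof -
    have "(\<lambda>x. coset_rep (M\<lparr>carrier := \<phi> ` K\<rparr>) (\<phi> ` L) (\<phi> x)) ` K =
        carrier (rquot (M\<lparr>carrier := \<phi> ` K\<rparr>) (\<phi> ` L))"
      by (simp add: rquot_def image_image)
    from less.IH[OF \<open>\<beta> < \<alpha>\<close> submodule_hom_subfactor[OF K L(1,2)] this]
    show ?thesis by (simp add: ker_subfactor[OF K L])
  qed
  show ?case
  proof (cases \<alpha>)
    case None
    have "carrier M = {\<zero>\<^bsub>M\<^esub>} \<longleftrightarrow> ker = J"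
      unfolding ker_def surj[symmetric] using domD(2) map_zero by force
    then show ?thesis
      using M.right_module_axioms
      unfolding None krull_class_None_iff deviation_le_None_iff zero_rmodule_def by simp
  next
    case (Some a)
    show ?thesis unfolding Some krull_class_Some_iff deviation_le_Some_iff
    proof (intro iffI allI impI conjI M.right_module_axioms)
      fix C :: "nat \<Rightarrow> _"
      assume M: "right_module R M \<and> (\<forall>C. (\<forall>i. rsubmodule R M (C i)) \<and> (\<forall>i. C (Suc i) \<subseteq> C i) \<longrightarrow>
          (\<exists>n. \<forall>i\<ge>n. \<exists>\<beta><Some a. krull_class R \<beta> (rquot (M\<lparr>carrier := C i\<rparr>) (C (Suc i)))))"
        and C: "(\<forall>i. C i \<in> {N. rsubmodule R P N} \<and> ker \<subseteq> C i \<and> C i \<subseteq> J) \<and>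
          (\<forall>i. C (Suc i) \<subseteq> C i)"
      have fac: "krull_class R \<beta> (rquot (M\<lparr>carrier := \<phi> ` C i\<rparr>) (\<phi> ` C (Suc i))) \<longleftrightarrow>
          deviation_le {N. rsubmodule R P N} \<beta> (C (Suc i)) (C i)" if "\<beta> < Some a" for i \<beta>
        using factor[of \<beta> "C i" "C (Suc i)"] C Some that by simp
      have "(\<forall>i. rsubmodule R M (\<phi> ` C i)) \<and> (\<forall>i. \<phi> ` C (Suc i) \<subseteq> \<phi> ` C i)"
        using C rsubmodule_image by (simp add: image_mono)
      then have "\<exists>n. \<forall>i\<ge>n. \<exists>\<beta><Some a.
          krull_class R \<beta> (rquot (M\<lparr>carrier := \<phi> ` C i\<rparr>) (\<phi> ` C (Suc i)))"
        using M[THEN conjunct2, rule_format, of "\<lambda>i. \<phi> ` C i"] by simp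
      then show "\<exists>n. \<forall>i\<ge>n. \<exists>\<beta><Some a. deviation_le {N. rsubmodule R P N} \<beta> (C (Suc i)) (C i)"
        using fac by (simp cong: conj_cong)
    next
      fix C :: "nat \<Rightarrow> _"
      assume D: "\<forall>C. (\<forall>i. C i \<in> {N. rsubmodule R P N} \<and> ker \<subseteq> C i \<and> C i \<subseteq> J) \<and>
          (\<forall>i. C (Suc i) \<subseteq> C i) \<longrightarrow>
          (\<exists>n. \<forall>i\<ge>n. \<exists>\<beta><Some a. deviation_le {N. rsubmodule R P N} \<beta> (C (Suc i)) (C i))"
        and C: "(\<forall>i. rsubmodule R M (C i)) \<and> (\<forall>i. C (Suc i) \<subseteq> C i)"
      \<comment> \<open>The chain is pulled back to \<open>J\<close>; since \<phi> is onto, pushing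
        it forward returns the original chain.\<close>
      define E where "E i = {x \<in> J. \<phi> x \<in> C i}" for i
      have E: "rsubmodule R P (E i)" "ker \<subseteq> E i" "E i \<subseteq> J" "E (Suc i) \<subseteq> E i" for i
        using C rsubmodule_vimage[of "C i"] M.rsubmoduleD(2)[of "C i"]
        unfolding E_def ker_def by auto
      have im: "\<phi> ` E i = C i" for i
        unfolding E_def using image_vimage[of "C i"] C M.rsubmoduleD(1)[of "C i"] surj by simp
      have fac: "krull_class R \<beta> (rquot (M\<lparr>carrier := C i\<rparr>) (C (Suc i))) \<longleftrightarrow>
          deviation_le {N. rsubmodule R P N} \<beta> (E (Suc i)) (E i)" if "\<beta> < Some a" for i \<beta>
        using factor[of \<beta> "E i" "E (Suc i)"] E im Some that by simp
      have "\<exists>n. \<forall>i\<ge>n. \<exists>\<beta><Some a. deviation_le {N. rsubmodule R P N} \<beta> (E (Suc i)) (E i)"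
        using D[rule_format, of E] E by simp
      then show "\<exists>n. \<forall>i\<ge>n. \<exists>\<beta><Some a. krull_class R \<beta> (rquot (M\<lparr>carrier := C i\<rparr>) (C (Suc i)))"
        using fac by (simp cong: conj_cong)
    qed
  qed
qed

section \<open>Cyclic submodules\<close>

definition cyclic_submodule ::
    "('a, 'c) ring_scheme \<Rightarrow> ('a, 'm) rmodule \<Rightarrow> 'm \<Rightarrow> 'm set" where
  "cyclic_submodule R M m = (\<lambda>r. m \<cdot>\<^bsub>M\<^esub> r) ` carrier R"

lemma right_module_regular:
  assumes "ring R"
  shows "right_module R (regular_rmodule R)"
proof -
  interpret ring R by fact
  have "abelian_group (regular_rmodule R)"
    by (rule abelian_groupI)
      (auto simp: regular_rmodule_def a_ac intro!: bexI[of _ "\<ominus>\<^bsub>R\<^esub> _"] l_neg)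
  then show ?thesis
    by (intro right_module.intro right_module_axioms.intro ring_axioms)
      (auto simp: regular_rmodule_def l_distr r_distr m_assoc)
qed

context right_module
begin

text \<open>Cyclic submodules are images, and annihilators and the right ideals (N : m) preimages,
  under this map; their closure properties are inherited from it.\<close>

lemma submodule_hom_orbit:
  assumes "m \<in> carrier M"
  shows "submodule_hom R (regular_rmodule R) M (carrier R) (\<lambda>r. m \<cdot>\<^bsub>M\<^esub> r)"
proof -
  have "rsubmodule R (regular_rmodule R) (carrier R)"
    using right_module.rsubmodule_carrier[OF right_module_regular[OF R.ring_axioms]]
    by (simp add: regular_rmodule_def)
  then show ?thesis
    using assms
    by (intro submodule_hom.intro submodule_hom_axioms.intro right_module_regular
        R.ring_axioms right_module_axioms)
      (auto simp: regular_rmodule_def rsmult_closed rsmult_add_right rsmult_assoc)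
qed

lemma rsubmodule_cyclic_submodule:
  assumes "m \<in> carrier M"
  shows "rsubmodule R M (cyclic_submodule R M m)"
proof -
  interpret h: submodule_hom R "regular_rmodule R" M "carrier R" "\<lambda>r. m \<cdot>\<^bsub>M\<^esub> r"
    using assms by (rule submodule_hom_orbit)
  show ?thesis unfolding cyclic_submodule_def by (rule h.rsubmodule_image[OF h.dom subset_refl])
qed

lemma mem_cyclic_submodule: "m \<in> carrier M \<Longrightarrow> m \<in> cyclic_submodule R M m"
  unfolding cyclic_submodule_def using rsmult_one[of m] by (metis R.one_closed imageI)

lemma cyclic_submodule_least:
  "\<lbrakk>rsubmodule R M N; m \<in> N\<rbrakk> \<Longrightarrow> cyclic_submodule R M m \<subseteq> N"
  unfolding cyclic_submodule_def by (auto simp: rsubmoduleD)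

lemma right_ideal_vimage_orbit:
  assumes N: "rsubmodule R M N" and m: "m \<in> carrier M"
  shows "right_ideal R {r \<in> carrier R. m \<cdot>\<^bsub>M\<^esub> r \<in> N}"
proof -
  interpret h: submodule_hom R "regular_rmodule R" M "carrier R" "\<lambda>r. m \<cdot>\<^bsub>M\<^esub> r"
    using m by (rule submodule_hom_orbit)
  show ?thesis by (rule h.rsubmodule_vimage[OF N])
qed

lemma right_ideal_annihilator:
  assumes "m \<in> carrier M"
  shows "right_ideal R (annihilator R M m)"
  using right_ideal_vimage_orbit[OF rsubmodule_zero assms] by (simp add: annihilator_def)

lemma submodule_hom_coset_rep:
  assumes N: "rsubmodule R M N"
  shows "submodule_hom R M (rquot M N) (carrier M) (coset_rep M N)"
  using rquot_hom[OF N]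
  by (intro submodule_hom.intro submodule_hom_axioms.intro right_module_axioms
      right_module_rquot[OF N] rsubmodule_carrier) auto

text \<open>The isomorphism \<open>mR \<rightarrow> R / ann m\<close> inverse to \<open>r \<mapsto> m r\<close>.\<close>

lemma cyclic_submodule_iso:
  assumes m: "m \<in> carrier M"
  defines "Q \<equiv> rquot (regular_rmodule R) (annihilator R M m)"
  obtains \<phi> where "submodule_hom R M Q (cyclic_submodule R M m) \<phi>"
    and "\<phi> ` cyclic_submodule R M m = carrier Q"
    and "submodule_hom.ker Q (cyclic_submodule R M m) \<phi> = {\<zero>\<^bsub>M\<^esub>}"
proof -
  let ?P = "regular_rmodule R" and ?I = "annihilator R M m"
  interpret P: right_module R ?P by (rule right_module_regular[OF R.ring_axioms])
  note I = right_ideal_annihilator[OF m]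
  have [simp]: "carrier ?P = carrier R" "add ?P = add R" "rsmult ?P = mult R" "zero ?P = zero R"
    by (simp_all add: regular_rmodule_def)
  \<comment> \<open>The choice of \<open>r\<close> is immaterial: two candidates differ by an
    element of the annihilator, as the next step checks.\<close>
  define \<phi> where "\<phi> x = coset_rep ?P ?I (SOME r. r \<in> carrier R \<and> m \<cdot>\<^bsub>M\<^esub> r = x)" for x
  have \<phi>: "\<phi> (m \<cdot>\<^bsub>M\<^esub> r) = coset_rep ?P ?I r" if r: "r \<in> carrier R" for r
  proof -
    define s where "s = (SOME s. s \<in> carrier R \<and> m \<cdot>\<^bsub>M\<^esub> s = m \<cdot>\<^bsub>M\<^esub> r)"
    have s: "s \<in> carrier R" "m \<cdot>\<^bsub>M\<^esub> s = m \<cdot>\<^bsub>M\<^esub> r"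
      using someI[of "\<lambda>s. s \<in> carrier R \<and> m \<cdot>\<^bsub>M\<^esub> s = m \<cdot>\<^bsub>M\<^esub> r" r] r by (simp_all add: s_def)
    have "m \<cdot>\<^bsub>M\<^esub> (s \<oplus>\<^bsub>R\<^esub> \<ominus>\<^bsub>R\<^esub> r) = m \<cdot>\<^bsub>M\<^esub> (r \<oplus>\<^bsub>R\<^esub> \<ominus>\<^bsub>R\<^esub> r)"
      using r s m by (simp add: rsmult_add_right del: R.r_neg)
    then have "s \<oplus>\<^bsub>R\<^esub> \<ominus>\<^bsub>R\<^esub> r \<in> ?I"
      using r s m by (simp add: annihilator_def R.r_neg rsmult_zero_right)
    moreover have "s = (s \<oplus>\<^bsub>R\<^esub> \<ominus>\<^bsub>R\<^esub> r) \<oplus>\<^bsub>R\<^esub> r"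
      using r s by (simp add: R.a_assoc R.l_neg)
    ultimately have "coset_rep ?P ?I s = coset_rep ?P ?I r"
      using r by (intro P.coset_rep_eqI[OF I, of r "s \<oplus>\<^bsub>R\<^esub> \<ominus>\<^bsub>R\<^esub> r"]) auto
    then show ?thesis by (simp add: \<phi>_def s_def)
  qed
  note h = P.rquot_hom[OF I, folded Q_def, simplified]
  have hom: "submodule_hom R M Q (cyclic_submodule R M m) \<phi>"
  proof (intro submodule_hom.intro submodule_hom_axioms.intro)
    show "right_module R M" by (rule right_module_axioms)
    show "right_module R Q" unfolding Q_def by (rule P.right_module_rquot[OF I])
    show "rsubmodule R M (cyclic_submodule R M m)" by (rule rsubmodule_cyclic_submodule[OF m])
  next
    fix x assume "x \<in> cyclic_submodule R M m"
    then obtain r where r: "r \<in> carrier R" "x = m \<cdot>\<^bsub>M\<^esub> r" by (auto simp: cyclic_submodule_def)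
    then show "\<phi> x \<in> carrier Q" by (simp add: \<phi> h)
    fix a assume a: "a \<in> carrier R"
    have "x \<cdot>\<^bsub>M\<^esub> a = m \<cdot>\<^bsub>M\<^esub> (r \<otimes>\<^bsub>R\<^esub> a)" using r a m by (simp add: rsmult_assoc)
    then show "\<phi> (x \<cdot>\<^bsub>M\<^esub> a) = \<phi> x \<cdot>\<^bsub>Q\<^esub> a" using r a by (simp add: \<phi> h)
  next
    fix x y assume "x \<in> cyclic_submodule R M m" "y \<in> cyclic_submodule R M m"
    then obtain r s where r: "r \<in> carrier R" "x = m \<cdot>\<^bsub>M\<^esub> r" "s \<in> carrier R" "y = m \<cdot>\<^bsub>M\<^esub> s"
      by (auto simp: cyclic_submodule_def)
    have "x \<oplus>\<^bsub>M\<^esub> y = m \<cdot>\<^bsub>M\<^esub> (r \<oplus>\<^bsub>R\<^esub> s)" using r m by (simp add: rsmult_add_right)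
    then show "\<phi> (x \<oplus>\<^bsub>M\<^esub> y) = \<phi> x \<oplus>\<^bsub>Q\<^esub> \<phi> y" using r by (simp add: \<phi> h)
  qed
  have surj: "\<phi> ` cyclic_submodule R M m = carrier Q"
    by (simp add: h(1) cyclic_submodule_def image_image \<phi> cong: image_cong)
  have zero: "\<phi> (m \<cdot>\<^bsub>M\<^esub> r) = \<zero>\<^bsub>Q\<^esub> \<longleftrightarrow> m \<cdot>\<^bsub>M\<^esub> r = \<zero>\<^bsub>M\<^esub>" if r: "r \<in> carrier R" for r
    using P.coset_rep_eq_zero_iff[OF I, of r] r by (simp add: \<phi> h(2)) (simp add: annihilator_def)
  have "{x \<in> cyclic_submodule R M m. \<phi> x = \<zero>\<^bsub>Q\<^esub>} = {\<zero>\<^bsub>M\<^esub>}"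
    using zero rsubmoduleD(2)[OF rsubmodule_cyclic_submodule[OF m]]
    by (auto simp: cyclic_submodule_def)
  then have ker: "submodule_hom.ker Q (cyclic_submodule R M m) \<phi> = {\<zero>\<^bsub>M\<^esub>}"
    using submodule_hom.ker_def[OF hom] by simp
  from that[OF hom surj ker] show ?thesis .
qed

end


section \<open>Cocritical point annihilators\<close>

context right_module
begin

text \<open>The larger submodule comes first in each pair, so a descending sequence of this relation
  is a strictly ascending chain.\<close>

lemma wf_noetherian:
  assumes noeth: "noetherian_rmodule R M"
  shows "wf {(K', K). rsubmodule R M K \<and> rsubmodule R M K' \<and> K \<subset> K'}"
  unfolding wf_iff_no_infinite_down_chain
proof
  assume "\<exists>C. \<forall>i. (C (Suc i), C i) \<in> {(K', K). rsubmodule R M K \<and> rsubmodule R M K' \<and> K \<subset> K'}"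
  then obtain C where
    C: "\<forall>i. (C (Suc i), C i) \<in> {(K', K). rsubmodule R M K \<and> rsubmodule R M K' \<and> K \<subset> K'}" ..
  have sub: "rsubmodule R M (C i)" and strict: "C i \<subset> C (Suc i)" for i
    using C[rule_format, of i] by simp_all
  have "\<exists>n. \<forall>i\<ge>n. C i = C n"
    by (rule noeth[unfolded noetherian_rmodule_def, THEN conjunct2, THEN spec, THEN mp])
      (intro conjI allI sub psubset_imp_subset[OF strict])
  then obtain n where n: "\<forall>i\<ge>n. C i = C n" ..
  show False using n[rule_format, of "Suc n"] strict[of n] by simp
qed

text \<open>A submodule of mR is recovered from its preimage in R. This injection into subsets of R
  places the bound in \<open>'a set ordinal\<close>, where the dimension of
  \<open>R / ann(m)\<close> is measured, whatever the type of \<open>M\<close>.\<close>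

lemma exists_deviation_le_cyclic_submodule:
  assumes noeth: "noetherian_rmodule R M" and m: "m \<in> carrier M"
  shows "\<exists>\<alpha>. deviation_le {N. rsubmodule R M N}
    (\<alpha> :: 'a set ordinal option) {\<zero>\<^bsub>M\<^esub>} (cyclic_submodule R M m)"
proof (rule exists_deviation_le)
  let ?X = "{K \<in> {N. rsubmodule R M N}. {\<zero>\<^bsub>M\<^esub>} \<subseteq> K \<and> K \<subseteq> cyclic_submodule R M m}"
  show "inj_on (\<lambda>K. {r \<in> carrier R. m \<cdot>\<^bsub>M\<^esub> r \<in> K}) ?X"
  proof (rule inj_on_inverseI)
    fix K assume "K \<in> ?X"
    then show "(\<lambda>r. m \<cdot>\<^bsub>M\<^esub> r) ` {r \<in> carrier R. m \<cdot>\<^bsub>M\<^esub> r \<in> K} = K"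
      by (auto simp: cyclic_submodule_def)
  qed
  show "{\<zero>\<^bsub>M\<^esub>} \<in> ?X"
    using rsubmodule_zero rsubmoduleD(2)[OF rsubmodule_cyclic_submodule[OF m]] by simp
  show "wf {(K', K). K \<in> ?X \<and> K' \<in> ?X \<and> K \<subset> K'}"
    by (rule wf_subset[OF wf_noetherian[OF noeth]]) auto
qed

text \<open>By \<open>dev\<close> and \<open>min\<close> the Krull dimension of
  \<open>R / ann(m)\<close> is exactly \<open>a\<close>, so criticality can fail only through a
  nonzero submodule whose quotient has no dimension below \<open>a\<close>. \<open>K\<close> is the
  corresponding submodule of mR.\<close>

lemma not_cocritical_annihilator:
  fixes a :: "'a set ordinal"
  assumes m: "m \<in> carrier M" and ncrit: "\<not> cocritical R (annihilator R M m)"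
    and dev: "deviation_le {N. rsubmodule R M N} (Some a) {\<zero>\<^bsub>M\<^esub>} (cyclic_submodule R M m)"
    and min: "\<And>\<beta>. \<beta> < Some a \<Longrightarrow>
      \<not> deviation_le {N. rsubmodule R M N} \<beta> {\<zero>\<^bsub>M\<^esub>} (cyclic_submodule R M m)"
  obtains K where "rsubmodule R M K" "K \<subseteq> cyclic_submodule R M m" "K \<noteq> {\<zero>\<^bsub>M\<^esub>}"
    "\<And>\<beta>. \<beta> < Some a \<Longrightarrow> \<not> deviation_le {N. rsubmodule R M N} \<beta> K (cyclic_submodule R M m)"
proof -
  let ?J = "cyclic_submodule R M m"
  define Q where "Q = rquot (regular_rmodule R) (annihilator R M m)"
  obtain \<phi> where hom: "submodule_hom R M Q ?J \<phi>" and surj: "\<phi> ` ?J = carrier Q"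
    and ker: "submodule_hom.ker Q ?J \<phi> = {\<zero>\<^bsub>M\<^esub>}"
    using cyclic_submodule_iso[OF m] unfolding Q_def by metis
  interpret h: submodule_hom R M Q ?J \<phi> by (rule hom)
  have "krull_class R \<beta> Q \<longleftrightarrow> deviation_le {N. rsubmodule R M N} \<beta> {\<zero>\<^bsub>M\<^esub>} ?J" for \<beta>
    using krull_class_iff_deviation_le[OF hom surj] ker by simp
  then have "is_krull_dim R Q (Some a)" using dev min by (simp add: is_krull_dim_def)
  moreover have "\<not> critical_rmodule R Q"
    using ncrit right_ideal_annihilator[OF m] unfolding cocritical_def Q_def by simp
  ultimately obtain N where N: "rsubmodule R Q N" "N \<noteq> {\<zero>\<^bsub>Q\<^esub>}"
    and no_dim: "\<And>\<beta>. \<beta> < Some a \<Longrightarrow> \<not> is_krull_dim R (rquot Q N) \<beta>"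
    unfolding critical_rmodule_def by auto
  \<comment> \<open>If the quotient lay in some class below \<open>a\<close>, the least index of a
    class containing it would be its dimension.\<close>
  have no_class: "\<not> krull_class R \<beta> (rquot Q N)" if "\<beta> < Some a" for \<beta>
  proof
    assume ex: "krull_class R \<beta> (rquot Q N)"
    let ?\<gamma> = "LEAST \<gamma>. krull_class R \<gamma> (rquot Q N)"
    have "is_krull_dim R (rquot Q N) ?\<gamma>"
      unfolding is_krull_dim_def using ex by (auto intro: LeastI dest: not_less_Least)
    moreover have "?\<gamma> < Some a" by (rule le_less_trans[OF Least_le that]) (rule ex)
    ultimately show False using no_dim by simp
  qed
  define K where "K = {x \<in> ?J. \<phi> x \<in> N}"
  have K: "rsubmodule R M K" "K \<subseteq> ?J" unfolding K_def using h.rsubmodule_vimage[OF N(1)] by auto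
  have im: "\<phi> ` K = N"
    unfolding K_def by (rule h.image_vimage) (simp add: surj h.M.rsubmoduleD(1)[OF N(1)])
  have "h.ker \<subseteq> K" unfolding ker using rsubmoduleD(2)[OF K(1)] by simp
  note sub = h.submodule_hom_subfactor[OF h.dom subset_refl K]
    h.ker_subfactor[OF h.dom subset_refl K this]
  \<comment> \<open>The subfactor lemmas speak of the image of \<phi> as a restricted module; here
    that is all of \<open>Q\<close>.\<close>
  have Q: "Q\<lparr>carrier := \<phi> ` ?J\<rparr> = Q" by (simp add: surj)
  have "krull_class R \<beta> (rquot Q N) \<longleftrightarrow> deviation_le {N. rsubmodule R M N} \<beta> K ?J" for \<beta>
    using krull_class_iff_deviation_le[OF sub(1)[unfolded Q im]] sub(2)[unfolded Q im]
    by (simp add: rquot_def surj[symmetric] image_image)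
  moreover have "K \<noteq> {\<zero>\<^bsub>M\<^esub>}" using im N(2) h.map_zero by auto
  ultimately show ?thesis using that K no_class by blast
qed

lemma exists_cocritical_point_annihilator:
  assumes noeth: "noetherian_rmodule R M" and nz: "\<not> zero_rmodule M"
  shows "\<exists>I. cocritical R I \<and> point_annihilator R M I"
proof -
  let ?dev = "deviation_le {N. rsubmodule R M N} :: 'a set ordinal option \<Rightarrow> _"
    and ?z = "{\<zero>\<^bsub>M\<^esub>}" and ?J = "cyclic_submodule R M"
  define bounded where
    "bounded \<alpha> \<longleftrightarrow> (\<exists>m\<in>carrier M. m \<noteq> \<zero>\<^bsub>M\<^esub> \<and> ?dev \<alpha> ?z (?J m))" for \<alpha>
  obtain m' where "m' \<in> carrier M" "m' \<noteq> \<zero>\<^bsub>M\<^esub>"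
    using nz M.zero_closed unfolding zero_rmodule_def by blast
  then have "\<exists>\<alpha>. bounded \<alpha>"
    using exists_deviation_le_cyclic_submodule[OF noeth, of m'] unfolding bounded_def by auto
  define \<alpha> where "\<alpha> = (LEAST \<alpha>. bounded \<alpha>)"
  have "bounded \<alpha>" unfolding \<alpha>_def using \<open>\<exists>\<alpha>. bounded \<alpha>\<close> by (rule LeastI_ex)
  then obtain m where m: "m \<in> carrier M" "m \<noteq> \<zero>\<^bsub>M\<^esub>" "?dev \<alpha> ?z (?J m)"
    unfolding bounded_def by auto
  \<comment> \<open>\<alpha> is least over all nonzero elements of \<open>M\<close>, so no nonzero
    cyclic submodule has smaller deviation.\<close>
  have min: "\<not> ?dev \<beta> ?z (?J n)" if "\<beta> < \<alpha>" "n \<in> carrier M" "n \<noteq> \<zero>\<^bsub>M\<^esub>" for \<beta> n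
    using not_less_Least[of \<beta> bounded] that unfolding \<alpha>_def bounded_def by auto
  have "\<alpha> \<noteq> None"
  proof
    assume "\<alpha> = None"
    then have "?J m = ?z" using m(3) by (simp add: deviation_le_None_iff)
    then show False using m(2) mem_cyclic_submodule[OF m(1)] by simp
  qed
  then obtain a where a: "\<alpha> = Some a" by auto
  note Jm = rsubmodule_cyclic_submodule[OF m(1)]
  show ?thesis
  proof (rule ccontr)
    assume none: "\<nexists>I. cocritical R I \<and> point_annihilator R M I"
    define good where "good n \<longleftrightarrow> n \<in> ?J m \<and> n \<noteq> \<zero>\<^bsub>M\<^esub>" for n
    have step: "\<exists>n'. good n' \<and> ?J n' \<subseteq> ?J n \<and> (\<forall>\<beta><Some a. \<not> ?dev \<beta> (?J n') (?J n))"
      if n: "good n" for n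
    proof -
      have nM: "n \<in> carrier M" "n \<noteq> \<zero>\<^bsub>M\<^esub>" "n \<in> ?J m"
        using n rsubmoduleD(1)[OF Jm] by (auto simp: good_def)
      have Jn: "?J n \<subseteq> ?J m" by (rule cyclic_submodule_least[OF Jm nM(3)])
      \<comment> \<open>nR inherits the bound from mR; with \<open>min\<close> its deviation is
        exactly \<open>a\<close>.\<close>
      have "?dev (Some a) ?z (?J n)"
        by (rule deviation_le_subinterval[OF m(3)[unfolded a]])
          (use Jn rsubmoduleD(2)[OF rsubmodule_cyclic_submodule[OF nM(1)]] in auto)
      moreover have "\<not> cocritical R (annihilator R M n)"
        using none nM(1,2) unfolding point_annihilator_def by auto
      ultimately obtain K where K: "rsubmodule R M K" "K \<subseteq> ?J n" "K \<noteq> ?z"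
        and ndev: "\<And>\<beta>. \<beta> < Some a \<Longrightarrow> \<not> ?dev \<beta> K (?J n)"
        using not_cocritical_annihilator[OF nM(1), of a] min[OF _ nM(1,2)] unfolding a by metis
      obtain n' where n': "n' \<in> K" "n' \<noteq> \<zero>\<^bsub>M\<^esub>" using K(3) rsubmoduleD(2)[OF K(1)] by blast
      have Jn': "?J n' \<subseteq> K" by (rule cyclic_submodule_least[OF K(1) n'(1)])
      \<comment> \<open>[K, nR] is a subinterval of [n'R, nR], so a bound for the latter would pass
        to the former.\<close>
      have "\<not> ?dev \<beta> (?J n') (?J n)" if "\<beta> < Some a" for \<beta>
        using ndev[OF that] deviation_le_subinterval[OF _ Jn' K(2) subset_refl] by auto
      moreover have "good n'" using n' K(2) Jn by (auto simp: good_def)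
      ultimately show ?thesis using Jn' K(2) by (intro exI[of _ n']) auto
    qed
    have "\<exists>f. \<forall>i::nat. good (f i) \<and>
        (?J (f (Suc i)) \<subseteq> ?J (f i) \<and> (\<forall>\<beta><Some a. \<not> ?dev \<beta> (?J (f (Suc i))) (?J (f i))))"
    proof (rule dependent_nat_choice)
      show "\<exists>n. good n" using m mem_cyclic_submodule by (auto simp: good_def)
    qed (use step in auto)
    then obtain f where f: "\<And>i::nat. good (f i)" "\<And>i. ?J (f (Suc i)) \<subseteq> ?J (f i)"
      "\<And>i \<beta>. \<beta> < Some a \<Longrightarrow> \<not> ?dev \<beta> (?J (f (Suc i))) (?J (f i))"
      by auto
    have "f i \<in> carrier M" for i using f(1)[of i] rsubmoduleD(1)[OF Jm] by (auto simp: good_def)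
    then have J: "rsubmodule R M (?J (f i))" for i by (rule rsubmodule_cyclic_submodule)
    have "?J (f i) \<subseteq> ?J m" for i
      by (rule cyclic_submodule_least[OF Jm]) (use f(1)[of i] in \<open>simp add: good_def\<close>)
    \<comment> \<open>The cyclic submodules form a chain in [0, mR], so the bound \<open>a\<close>
      makes almost all of its factors small.\<close>
    then have "\<exists>n. \<forall>i\<ge>n. \<exists>\<beta><Some a. ?dev \<beta> (?J (f (Suc i))) (?J (f i))"
      using m(3)[unfolded a deviation_le_Some_iff, rule_format, of "\<lambda>i. ?J (f i)"]
        J f(2) rsubmoduleD(2)[OF J] by simp
    then show False using f(3) by auto
  qed
qed

end


section \<open>A criterion for right noetherian rings\<close>

text \<open>A nonzero submodule of M/P is the image of a submodule strictly above \<open>P\<close>,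
  which is finitely generated by maximality.\<close>

lemma noetherian_rquot_maximal_not_finitely_generated:
  assumes "right_module R M" and P: "rsubmodule R M P"
    and max: "\<And>L. \<lbrakk>rsubmodule R M L; P \<subset> L\<rbrakk> \<Longrightarrow> finitely_generated R M L"
  shows "noetherian_rmodule R (rquot M P)"
proof -
  interpret right_module R M by fact
  interpret h: submodule_hom R M "rquot M P" "carrier M" "coset_rep M P"
    by (rule submodule_hom_coset_rep[OF P])
  have zero: "coset_rep M P x = \<zero>\<^bsub>rquot M P\<^esub>" if "x \<in> P" for x
    using that coset_rep_eq_zero_iff[OF P] rsubmoduleD(1)[OF P] rquot_hom(2)[OF P] by auto
  have "finitely_generated R (rquot M P) N" if N: "rsubmodule R (rquot M P) N" for N
  proof -
    define K where "K = {x \<in> carrier M. coset_rep M P x \<in> N}"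
    have K: "rsubmodule R M K" unfolding K_def by (rule h.rsubmodule_vimage[OF N])
    have im: "coset_rep M P ` K = N"
      unfolding K_def
      by (rule h.image_vimage) (use h.M.rsubmoduleD(1)[OF N] rquot_hom(1)[OF P] in simp)
    have PK: "P \<subseteq> K" using zero rsubmoduleD(1)[OF P] h.M.rsubmoduleD(2)[OF N] by (auto simp: K_def)
    show ?thesis
    proof (cases "P = K")
      case True
      then have "N = {\<zero>\<^bsub>rquot M P\<^esub>}" using zero rsubmoduleD(2)[OF P] im by force
      then show ?thesis using h.M.finitely_generated_zero by simp
    next
      case False
      then have "finitely_generated R M K" using max K PK by blast
      then show ?thesis using h.finitely_generated_image im rsubmoduleD(1)[OF K] by metis
    qed
  qed
  then show ?thesis using h.M.noetherian_iff_finitely_generated by simp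
qed

text \<open>Suppose a nonzero L meets (P : m) trivially. Then mL is nonzero, as otherwise L would
  lie in (P : m). So P contains a nonzero ml with l in L, and this l is a nonzero element of L
  \<inter> (P : m).\<close>

lemma essential_quotient:
  assumes "ring R" and P: "essential_right_ideal R P" and m: "m \<in> carrier R"
  shows "essential_right_ideal R {r \<in> carrier R. m \<otimes>\<^bsub>R\<^esub> r \<in> P}"
proof -
  interpret ring R by fact
  let ?P = "regular_rmodule R"
  have [simp]: "carrier ?P = carrier R" "add ?P = add R" "rsmult ?P = mult R" "zero ?P = zero R"
    by (simp_all add: regular_rmodule_def)
  interpret M: right_module R ?P by (rule right_module_regular[OF ring_axioms])
  interpret h: submodule_hom R ?P ?P "carrier R" "\<lambda>r. m \<otimes>\<^bsub>R\<^esub> r"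
    using M.submodule_hom_orbit[of m] m by simp
  have P': "right_ideal R P" using P by (simp add: essential_submodule_def)
  show ?thesis unfolding essential_submodule_def
  proof (intro conjI allI impI notI)
    show "right_ideal R {r \<in> carrier R. m \<otimes>\<^bsub>R\<^esub> r \<in> P}" by (rule h.rsubmodule_vimage[OF P'])
  next
    fix L assume L: "right_ideal R L \<and> L \<noteq> {\<zero>\<^bsub>?P\<^esub>}"
      and Int: "{r \<in> carrier R. m \<otimes>\<^bsub>R\<^esub> r \<in> P} \<inter> L = {\<zero>\<^bsub>?P\<^esub>}"
    have LR: "L \<subseteq> carrier R" using M.rsubmoduleD(1)[of L] L by simp
    let ?mL = "(\<lambda>r. m \<otimes>\<^bsub>R\<^esub> r) ` L"
    have zP: "\<zero>\<^bsub>R\<^esub> \<in> P" using M.rsubmoduleD(2)[OF P'] by simp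
    have unique: "l = \<zero>\<^bsub>R\<^esub>" if "l \<in> L" "m \<otimes>\<^bsub>R\<^esub> l \<in> P" for l
    proof -
      have "l \<in> {r \<in> carrier R. m \<otimes>\<^bsub>R\<^esub> r \<in> P} \<inter> L" using that LR by auto
      then show ?thesis unfolding Int by simp
    qed
    have "?mL \<noteq> {\<zero>\<^bsub>R\<^esub>}"
    proof
      assume mL: "?mL = {\<zero>\<^bsub>R\<^esub>}"
      have "l = \<zero>\<^bsub>R\<^esub>" if "l \<in> L" for l
      proof (rule unique[OF that])
        have "m \<otimes>\<^bsub>R\<^esub> l \<in> ?mL" using that by (rule imageI)
        then show "m \<otimes>\<^bsub>R\<^esub> l \<in> P" using zP unfolding mL by simp
      qed
      then have "L \<subseteq> {\<zero>\<^bsub>R\<^esub>}" by auto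
      then show False using L M.rsubmoduleD(2)[of L] by (auto dest: subset_singletonD)
    qed
    moreover have mL: "right_ideal R ?mL"
      by (rule h.rsubmodule_image) (use L LR in auto)
    ultimately have "P \<inter> ?mL \<noteq> {\<zero>\<^bsub>R\<^esub>}"
      using P[unfolded essential_submodule_def, THEN conjunct2, THEN spec[of _ ?mL]] by simp
    moreover have "P \<inter> ?mL \<subseteq> {\<zero>\<^bsub>R\<^esub>}"
    proof
      fix x assume "x \<in> P \<inter> ?mL"
      then obtain l where l: "l \<in> L" "x = m \<otimes>\<^bsub>R\<^esub> l" "x \<in> P" by auto
      then show "x \<in> {\<zero>\<^bsub>R\<^esub>}" using unique[of l] m by simp
    qed
    moreover have "\<zero>\<^bsub>R\<^esub> \<in> P \<inter> ?mL"
      using zP M.rsubmoduleD(2)[OF mL] by simp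
    ultimately show False by (metis empty_iff singletonD subset_singletonD)
  qed
qed

text \<open>
  A right ideal \<open>P\<close> maximal among those that are not finitely generated is essential, and
  \<open>R/P\<close> is noetherian.  If \<open>Q = (P : m)\<close> is finitely generated for some \<open>m\<close> outside \<open>P\<close>,
  then so are \<open>P \<inter> mR = mQ\<close> and \<open>P + mR\<close>, hence also \<open>P\<close>.
\<close>

lemma right_noetherian_if_essential_finitely_generated:
  fixes R :: "('a, 'c) ring_scheme"
  assumes "ring R" and S: "right_noetherian_point_annihilator_set TYPE('a) R S"
    and fg: "\<And>I. \<lbrakk>I \<in> S; essential_right_ideal R I\<rbrakk> \<Longrightarrow>
      finitely_generated R (regular_rmodule R) I"
  shows "right_noetherian R"
proof (rule ccontr)
  assume "\<not> right_noetherian R"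
  interpret ring R by fact
  let ?M = "regular_rmodule R"
  have [simp]: "carrier ?M = carrier R" "add ?M = add R" "rsmult ?M = mult R" "zero ?M = zero R"
    by (simp_all add: regular_rmodule_def)
  interpret M: right_module R ?M by (rule right_module_regular[OF ring_axioms])
  obtain N where "right_ideal R N" "\<not> finitely_generated R ?M N"
    using \<open>\<not> right_noetherian R\<close> M.noetherian_iff_finitely_generated
    unfolding right_noetherian_def by auto
  then obtain P where P: "right_ideal R P" "\<not> finitely_generated R ?M P"
    and "\<forall>L. right_ideal R L \<longrightarrow> P \<subset> L \<longrightarrow> finitely_generated R ?M L"
    by (rule M.exists_maximal_not_finitely_generated)
  then have max: "finitely_generated R ?M L" if "right_ideal R L" "P \<subset> L" for L
    using that by simp
  have ess: "essential_right_ideal R P"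
    by (rule M.essential_maximal_not_finitely_generated[OF P max])
  note h = M.rquot_hom[OF P(1), simplified]
  have zero_iff: "coset_rep ?M P x = \<zero>\<^bsub>rquot ?M P\<^esub> \<longleftrightarrow> x \<in> P" if "x \<in> carrier R" for x
    using M.coset_rep_eq_zero_iff[OF P(1), of x] that h(2) by simp
  have "noetherian_rmodule R (rquot ?M P)"
    by (rule noetherian_rquot_maximal_not_finitely_generated[OF M.right_module_axioms P(1) max])
  moreover have "\<not> zero_rmodule (rquot ?M P)"
  proof
    assume "zero_rmodule (rquot ?M P)"
    then have "\<one>\<^bsub>R\<^esub> \<in> P" using zero_iff[of "\<one>\<^bsub>R\<^esub>"] h(1) by (auto simp: zero_rmodule_def)
    \<comment> \<open>With 1 in \<open>P\<close>, the right ideal \<open>P\<close> would be R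
      itself, generated by 1.\<close>
    then have "finitely_generated R ?M P"
    proof (intro M.finitely_generatedI[OF P(1), of "{\<one>\<^bsub>R\<^esub>}"])
      fix L assume L: "right_ideal R L" "{\<one>\<^bsub>R\<^esub>} \<subseteq> L"
      have "x \<in> L" if "x \<in> carrier R" for x
        using M.rsubmoduleD(4)[OF L(1), of "\<one>\<^bsub>R\<^esub>" x] L(2) that by simp
      then show "P \<subseteq> L" using M.rsubmoduleD(1)[OF P(1)] by auto
    qed auto
    then show False using P(2) by simp
  qed
  ultimately obtain Q where Q: "Q \<in> S" "point_annihilator R (rquot ?M P) Q"
    using S unfolding right_noetherian_point_annihilator_set_def by blast
  then obtain m where m: "m \<in> carrier R" "coset_rep ?M P m \<noteq> \<zero>\<^bsub>rquot ?M P\<^esub>"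
    and Q_eq: "Q = annihilator R (rquot ?M P) (coset_rep ?M P m)"
    unfolding point_annihilator_def h(1) by auto
  have "m \<notin> P" using m zero_iff by simp
  have Q_eq: "Q = {r \<in> carrier R. m \<otimes>\<^bsub>R\<^esub> r \<in> P}"
    unfolding Q_eq annihilator_def using m(1) h(4) zero_iff by auto
  then have fgQ: "finitely_generated R ?M Q"
    using fg[OF Q(1)] essential_quotient[OF ring_axioms ess m(1)] by simp
  interpret l: submodule_hom R ?M ?M "carrier R" "\<lambda>r. m \<otimes>\<^bsub>R\<^esub> r"
    using M.submodule_hom_orbit[of m] m by simp
  let ?J = "cyclic_submodule R ?M m"
  have J: "right_ideal R ?J" using M.rsubmodule_cyclic_submodule m(1) by simp
  have "P \<inter> ?J = (\<lambda>r. m \<otimes>\<^bsub>R\<^esub> r) ` Q" unfolding Q_eq cyclic_submodule_def by auto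
  then have fg_Int: "finitely_generated R ?M (P \<inter> ?J)"
    using l.finitely_generated_image[OF fgQ] Q_eq by auto
  have "P \<subset> P <+>\<^bsub>?M\<^esub> ?J"
    using M.subset_set_add[OF P(1) J] M.mem_cyclic_submodule[of m] m(1) \<open>m \<notin> P\<close> by auto
  then have "finitely_generated R ?M (P <+>\<^bsub>?M\<^esub> ?J)"
    by (rule max[OF M.rsubmodule_set_add[OF P(1) J]])
  then show False using M.finitely_generated_of_set_add[OF P(1) J _ fg_Int] P(2) by simp
qed

theorem theorem6p10:
  fixes R :: "('a, 'c) ring_scheme"
  assumes "ring R"
  shows "(\<forall>S. right_noetherian_point_annihilator_set TYPE('a list) R S \<longrightarrow>
            (right_noetherian R \<longleftrightarrow>
              (\<forall>I\<in>S. essential_right_ideal R I \<longrightarrow> finitely_generated R (regular_rmodule R) I)))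
       \<and> right_noetherian_point_annihilator_set TYPE('m) R {I. cocritical R I}"
proof (intro conjI allI impI iffI ballI)
  fix S I
  assume "right_noetherian R" "essential_right_ideal R I"
  then show "finitely_generated R (regular_rmodule R) I"
    using right_module.noetherian_iff_finitely_generated[OF right_module_regular[OF assms]]
    unfolding right_noetherian_def essential_submodule_def by simp
next
  fix S
  assume S: "right_noetherian_point_annihilator_set TYPE('a list) R S"
    and fg: "\<forall>I\<in>S. essential_right_ideal R I \<longrightarrow> finitely_generated R (regular_rmodule R) I"
  show "right_noetherian R"
    \<comment> \<open>The test module R/P is carried by \<open>'a\<close>, so the hypothesis is
      first transferred there from \<open>'a list\<close>.\<close>
    by (rule right_noetherian_if_essential_finitely_generated[OF assms
        right_noetherian_point_annihilator_set_any_type[OF S]])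
      (simp add: fg)
next
  show "right_noetherian_point_annihilator_set TYPE('m) R {I. cocritical R I}"
    unfolding right_noetherian_point_annihilator_set_def
  proof (intro conjI ballI allI impI)
    fix I assume "I \<in> {I. cocritical R I}"
    then show "right_ideal R I" by (simp add: cocritical_def)
  next
    fix M :: "('a, 'm) rmodule"
    assume M: "noetherian_rmodule R M \<and> \<not> zero_rmodule M"
    then have "\<exists>I. cocritical R I \<and> point_annihilator R M I"
      by (intro right_module.exists_cocritical_point_annihilator)
        (simp_all add: noetherian_rmodule_def)
    then show "\<exists>I\<in>{I. cocritical R I}. point_annihilator R M I" by simp
  qed
qed

end
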